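(* Let $A_3=\{0,1,2\}$, let $\mathrm{MSE}$ be the monoid (under composition) of morphisms with Sturmian erasures on $A_3$, and let $\mathrm{MSE}^{\varepsilon}$ be the set of those $f\in\mathrm{MSE}$ for which there is a letter $l\in A_3$ with $f(l)=\varepsilon$. Then: (1) The monoid $\mathrm{MSE}$ is not finitely generated. (2) $\mathrm{MSE}$ is the union of $\mathrm{MSE}^{\varepsilon}$ and the set of permutations of $A_3$ (viewed as morphisms sending letters to letters). (3) If $f:A_3\to A_3^*$ is a morphism that is locally with Sturmian erasures and such that $f(i)=\varepsilon$ for some $i\in A_3$, then $f\in\mathrm{MSE}$.
   Context: For a finite alphabet $A$, $A^*$ is the free monoid of finite words over $A$, $\varepsilon$ is the empty word, and $A^{\mathbb N}$ is the set of infinite words. A morphism $f:A\to B^*$ extends by concatenation to finite words and to infinite words (the image of an infinite word is a finite or infinite word, since letters may be sent to $\varepsilon$). For an infinite word $x$, $P_x(n)$ is the number of distinct factors (finite contiguous subwords) of length $n$ of $x$; an infinite word $x$ over a finite alphabet is Sturmian if $P_x(n)=n+1$ for all $n\in\mathbb N$. Let $A_3=\{0,1,2\}$. For $i\in A_3$, $\pi_i:A_3\to A_3^*$ is the morphism with $\pi_i(i)=\varepsilon$ and $\pi_i(j)=j$ for $j\neq i$. A word $x\in A_3^{\mathbb N}$ is a word with Sturmian erasures if $\pi_i(x)$ is a Sturmian word for every $i\in A_3$. A morphism $f:A_3\to A_3^*$ is a morphism with Sturmian erasures if $f(x)$ is a word with Sturmian erasures for every word $x\in A_3^{\mathbb N}$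 with Sturmian erasures; $\mathrm{MSE}$ denotes the set of all such morphisms. A morphism $f:A_3\to A_3^*$ is locally with Sturmian erasures if there exists at least one word $x\in A_3^{\mathbb N}$ with Sturmian erasures such that $f(x)$ is a word with Sturmian erasures. *)

theory Defs
  imports "HOL-Library.Omega_Words_Fun" "HOL-Algebra.Group"
begin

section \<open>Morphisms and images of infinite words\<close>

text \<open>A morphism from \<open>A\<close> to \<open>B\<^sup>*\<close> is given by its values on letters;
  finite words are lists, infinite words are functions on the naturals.\<close>

type_synonym ('a, 'b) morphism = "'a \<Rightarrow> 'b list"

definition apply_fin :: "('a, 'b) morphism \<Rightarrow> 'a list \<Rightarrow> 'b list" where
  "apply_fin f w = concat (map f w)"

definition comp_mor :: "('b, 'c) morphism \<Rightarrow> ('a, 'b) morphism \<Rightarrow> ('a, 'c) morphism" where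
  "comp_mor f g = (\<lambda>a. apply_fin f (g a))"

definition id_mor :: "('a, 'a) morphism" where
  "id_mor = (\<lambda>a. [a])"

datatype 'a fin_or_inf = Fin "'a list" | Inf "'a word"

definition infinite_image :: "('a, 'b) morphism \<Rightarrow> 'a word \<Rightarrow> bool" where
  "infinite_image f x \<longleftrightarrow> (\<forall>k. \<exists>n. k < length (apply_fin f (prefix n x)))"

text \<open>The \<open>k\<close>-th letter of an infinite image is read off from the image of any prefix
  that is long enough. A finite image is the image of a prefix after which only letters
  mapped to the empty word occur.\<close>

definition apply_inf :: "('a, 'b) morphism \<Rightarrow> 'a word \<Rightarrow> 'b fin_or_inf" where
  "apply_inf f x =
     (if infinite_image f x
      then Inf (\<lambda>k. apply_fin f (prefix (LEAST n. k < length (apply_fin f (prefix n x))) x) ! k)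
      else Fin (apply_fin f (prefix (LEAST n. \<forall>m\<ge>n. f (x m) = []) x)))"

section \<open>Sturmian words\<close>

definition factors :: "'a word \<Rightarrow> 'a list set" where
  "factors x = {x [i \<rightarrow> j] | i j. i \<le> j}"

definition complexity :: "'a word \<Rightarrow> nat \<Rightarrow> nat" where
  "complexity x n = card {w \<in> factors x. length w = n}"

definition sturmian :: "'a word \<Rightarrow> bool" where
  "sturmian x \<longleftrightarrow> finite (range x) \<and> (\<forall>n. complexity x n = n + 1)"

section \<open>Sturmian erasures\<close>

datatype letter = L0 | L1 | L2

definition erase :: "letter \<Rightarrow> (letter, letter) morphism" where
  "erase i = (\<lambda>j. if j = i then [] else [j])"

definition sturmian_erasures :: "letter word \<Rightarrow> bool" where
  "sturmian_erasures x \<longleftrightarrow> (\<forall>i. \<exists>y. apply_inf (erase i) x = Inf y \<and> sturmian y)"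

definition image_sturmian_erasures :: "(letter, letter) morphism \<Rightarrow> letter word \<Rightarrow> bool" where
  "image_sturmian_erasures f x \<longleftrightarrow> (\<exists>y. apply_inf f x = Inf y \<and> sturmian_erasures y)"

definition MSE :: "(letter, letter) morphism set" where
  "MSE = {f. \<forall>x. sturmian_erasures x \<longrightarrow> image_sturmian_erasures f x}"

definition MSE_eps :: "(letter, letter) morphism set" where
  "MSE_eps = {f \<in> MSE. \<exists>l. f l = []}"

definition locally_sturmian_erasures :: "(letter, letter) morphism \<Rightarrow> bool" where
  "locally_sturmian_erasures f \<longleftrightarrow> (\<exists>x. sturmian_erasures x \<and> image_sturmian_erasures f x)"

definition permutation_morphisms :: "(letter, letter) morphism set" where
  "permutation_morphisms = {\<lambda>a. [p a] | p. bij p}"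

section \<open>The monoid of morphisms with Sturmian erasures\<close>

definition MSE_monoid :: "(letter, letter) morphism monoid" where
  "MSE_monoid = \<lparr>carrier = MSE, mult = comp_mor, one = id_mor\<rparr>"

definition generated_submonoid :: "('a, 'b) monoid_scheme \<Rightarrow> 'a set \<Rightarrow> 'a set" where
  "generated_submonoid G S = \<Inter>{H. submonoid H G \<and> S \<subseteq> H}"

definition finitely_generated :: "('a, 'b) monoid_scheme \<Rightarrow> bool" where
  "finitely_generated G \<longleftrightarrow>
     (\<exists>S. finite S \<and> S \<subseteq> carrier G \<and> generated_submonoid G S = carrier G)"

lemma apply_fin_append [simp]: "apply_fin f (u @ v) = apply_fin f u @ apply_fin f v"
  by (simp add: apply_fin_def)

lemma comp_mor_apply: "comp_mor f g a = apply_fin f (g a)"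
  by (simp add: comp_mor_def)

lemma apply_fin_comp: "apply_fin (comp_mor f g) w = apply_fin f (apply_fin g w)"
  by (induction w) (simp_all add: comp_mor_def apply_fin_def)

lemma apply_fin_id [simp]: "apply_fin id_mor w = w"
  by (induction w) (simp_all add: id_mor_def apply_fin_def)

lemma apply_fin_prefix_nth:
  assumes "k < length (apply_fin f (prefix m x))" "k < length (apply_fin f (prefix n x))"
  shows "apply_fin f (prefix m x) ! k = apply_fin f (prefix n x) ! k"
proof -
  have *: "apply_fin f (prefix (m + d) x) ! k = apply_fin f (prefix m x) ! k"
    if "k < length (apply_fin f (prefix m x))" for m d
    unfolding subsequence_append using that by (simp add: nth_append)
  show ?thesis
    using *[of m "n - m"] *[of n "m - n"] assms by (cases "m \<le> n") auto
qed

lemma apply_inf_eq_Inf_iff: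
  "apply_inf f x = Inf y \<longleftrightarrow>
     infinite_image f x \<and>
     (\<forall>n. apply_fin f (prefix n x) = prefix (length (apply_fin f (prefix n x))) y)"
  (is "?L \<longleftrightarrow> ?I \<and> ?R")
proof
  assume L: ?L
  then have I: ?I by (auto simp: apply_inf_def split: if_splits)
  have "apply_fin f (prefix n x) ! k = y k" if k: "k < length (apply_fin f (prefix n x))" for n k
  proof -
    let ?m = "LEAST n. k < length (apply_fin f (prefix n x))"
    have "y k = apply_fin f (prefix ?m x) ! k"
      using L I by (auto simp: apply_inf_def)
    moreover have "k < length (apply_fin f (prefix ?m x))"
      by (rule LeastI) (rule k)
    ultimately show ?thesis using apply_fin_prefix_nth k by metis
  qed
  then have ?R by (auto intro!: nth_equalityI)
  with I show "?I \<and> ?R" ..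
next
  assume R: "?I \<and> ?R"
  have "apply_fin f (prefix (LEAST n. k < length (apply_fin f (prefix n x))) x) ! k = y k" for k
  proof -
    let ?m = "LEAST n. k < length (apply_fin f (prefix n x))"
    obtain n where "k < length (apply_fin f (prefix n x))"
      using R by (auto simp: infinite_image_def)
    then have k: "k < length (apply_fin f (prefix ?m x))"
      by (rule LeastI)
    from R have "apply_fin f (prefix ?m x) = prefix (length (apply_fin f (prefix ?m x))) y"
      by blast
    then have "apply_fin f (prefix ?m x) ! k = prefix (length (apply_fin f (prefix ?m x))) y ! k"
      by (rule arg_cong)
    with k show ?thesis by simp
  qed
  with R show ?L by (auto simp: apply_inf_def)
qed

lemma apply_inf_id: "apply_inf id_mor x = Inf x"
  by (auto simp: apply_inf_eq_Inf_iff infinite_image_def)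

lemma apply_inf_comp:
  assumes g: "apply_inf g x = Inf y" and f: "apply_inf f y = Inf z"
  shows "apply_inf (comp_mor f g) x = Inf z"
proof -
  let ?l = "\<lambda>n. length (apply_fin g (prefix n x))"
  from g have gi: "infinite_image g x"
    and gp: "\<And>n. apply_fin g (prefix n x) = prefix (?l n) y"
    by (auto simp: apply_inf_eq_Inf_iff)
  from f have fi: "infinite_image f y"
    and fp: "\<And>n. apply_fin f (prefix n y) = prefix (length (apply_fin f (prefix n y))) z"
    by (auto simp: apply_inf_eq_Inf_iff)
  have comp: "apply_fin (comp_mor f g) (prefix n x) = apply_fin f (prefix (?l n) y)" for n
    using gp[of n] by (simp add: apply_fin_comp)
  have "\<exists>n. k < length (apply_fin (comp_mor f g) (prefix n x))" for k
  proof -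
    obtain m where m: "k < length (apply_fin f (prefix m y))"
      using fi by (auto simp: infinite_image_def)
    obtain n where n: "m < ?l n"
      using gi by (auto simp: infinite_image_def)
    have "prefix (?l n) y = prefix m y @ (y [m \<rightarrow> ?l n])"
      using n subsequence_append[where i=m and j="?l n - m" and w=y] by simp
    then have "k < length (apply_fin f (prefix (?l n) y))"
      using m by simp
    then show ?thesis using comp by metis
  qed
  moreover have "apply_fin (comp_mor f g) (prefix n x)
      = prefix (length (apply_fin (comp_mor f g) (prefix n x))) z" for n
    unfolding comp by (rule fp)
  ultimately show ?thesis
    by (simp add: apply_inf_eq_Inf_iff infinite_image_def)
qed

lemma comp_mor_in_MSE:
  assumes "f \<in> MSE" "g \<in> MSE"
  shows "comp_mor f g \<in> MSE"
  using assms apply_inf_comp unfolding MSE_def image_sturmian_erasures_def by blast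

lemma monoid_MSE: "monoid MSE_monoid"
proof (rule monoidI)
  show "\<one>\<^bsub>MSE_monoid\<^esub> \<in> carrier MSE_monoid"
    by (simp add: MSE_monoid_def MSE_def image_sturmian_erasures_def apply_inf_id)
next
  fix f g assume "f \<in> carrier MSE_monoid" "g \<in> carrier MSE_monoid"
  then show "f \<otimes>\<^bsub>MSE_monoid\<^esub> g \<in> carrier MSE_monoid"
    by (simp add: MSE_monoid_def comp_mor_in_MSE)
next
  fix f g h
  show "(f \<otimes>\<^bsub>MSE_monoid\<^esub> g) \<otimes>\<^bsub>MSE_monoid\<^esub> h = f \<otimes>\<^bsub>MSE_monoid\<^esub> (g \<otimes>\<^bsub>MSE_monoid\<^esub> h)"
    by (rule ext) (simp add: MSE_monoid_def apply_fin_comp comp_mor_apply)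
next
  fix f
  show "\<one>\<^bsub>MSE_monoid\<^esub> \<otimes>\<^bsub>MSE_monoid\<^esub> f = f"
    by (rule ext) (simp add: MSE_monoid_def comp_mor_def)
  show "f \<otimes>\<^bsub>MSE_monoid\<^esub> \<one>\<^bsub>MSE_monoid\<^esub> = f"
    by (rule ext) (simp add: MSE_monoid_def comp_mor_def id_mor_def apply_fin_def)
qed

end

theory Submission
  imports Defs
begin

text \<open>The proof rests on the structure of Sturmian morphisms on two letters. Such a morphism is a
  product of the exchange of the letters and of elementary morphisms \<open>c \<mapsto> c\<close>, \<open>d \<mapsto> cd\<close> and
  \<open>c \<mapsto> c\<close>, \<open>d \<mapsto> dc\<close>, and a morphism that maps one Sturmian word to a Sturmian word is already of this
  form (\<open>locally_sturmian_imp_sturmian_mor\<close>), so that it preserves all Sturmian words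
  (\<open>sturmian_mor_preserves\<close>). A binary word is Sturmian if and only if it has exactly one right special
  factor of each length, and the right special factors of its image under an elementary
  morphism are, up to suffixes, the images of its own; this gives preservation, and it allows to
  split elementary morphisms off a locally Sturmian one by induction on the lengths of the images.
  The remaining case is that the images of the two letters differ in their first and in their last letters. Composing on the right
  with an elementary morphism leads back to the induction hypothesis, and since \<open>g(01)\<close> and \<open>g(10)\<close>
  differ by one exchange of adjacent letters for all products \<open>g\<close> of generators
  (\<open>sturmian_mor_differ\<close>), only bijections of the letters remain. The determinant of a Sturmian
  morphism is a unit (\<open>sturmian_mor_det\<close>).

  Part (3): if \<open>f\<close> erases \<open>i\<close>, then \<open>f\<close> followed by the erasure of \<open>l\<close> acts on the Sturmian word that is
  left after erasing \<open>i\<close> as a binary morphism. If \<open>f\<close> is locally with Sturmian erasures, these three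
  binary morphisms are locally Sturmian, hence Sturmian, and then \<open>f\<close> is in MSE.

  Part (2): inserting a letter \<open>m\<close> after each letter of a Sturmian word over the other two letters
  yields a word with Sturmian erasures. Apply \<open>f\<close> and erase \<open>l\<close>: for each \<open>m\<close> this is a Sturmian morphism,
  whose determinant is a signed sum of the three minors of a \<open>2 \<times> 3\<close> matrix. All three sums are
  units only if a column of the matrix is zero (\<open>det_units_erase\<close>), so that \<open>f\<close> maps some letter
  into the powers of \<open>l\<close>. If \<open>f\<close> erases no letter, these powers are nontrivial, and
  the determinants show that \<open>f\<close> is a permutation.

  Part (1): the morphism \<open>0 \<mapsto> (21)\<^sup>n20\<close>, \<open>1 \<mapsto> 12\<close>, \<open>2 \<mapsto> \<epsilon>\<close> is in MSE. In a product that equals it, let \<open>G\<close>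
  consist of the factors up to the first erasing one. What follows \<open>G\<close> acts as a binary Sturmian
  morphism, and such a morphism, unless it just renames letters, gives both images a common first or
  a common last letter, which these two words do not have. So \<open>(21)\<^sup>n20\<close> is the image of a letter
  under \<open>G\<close>, and its length is bounded by the lengths of the images under the generators. Hence no
  finite set of generators suffices for all \<open>n\<close>.\<close>

section \<open>Factors and images of infinite words\<close>

lemma factors_iff: "w \<in> factors x \<longleftrightarrow> (\<exists>i. w = subsequence x i (i + length w))"
proof
  assume "w \<in> factors x"
  then obtain i j where "i \<le> j" "w = subsequence x i j" by (auto simp: factors_def)
  then show "\<exists>i. w = subsequence x i (i + length w)" by (intro exI[of _ i]) simp
next
  assume "\<exists>i. w = subsequence x i (i + length w)"
  then show "w \<in> factors x" unfolding factors_def using le_add1 by blast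
qed

lemma subsequence_in_factors: "i \<le> j \<Longrightarrow> subsequence x i j \<in> factors x"
  by (auto simp: factors_def)

lemma subsequence_split: "i \<le> j \<Longrightarrow> j \<le> k \<Longrightarrow> subsequence x i k = subsequence x i j @ subsequence x j k"
  by (metis le_Suc_ex map_append subsequence_def upt_add_eq_append)

lemma subsequence_suffix: "subsequence (suffix k x) i j = subsequence x (k + i) (k + j)"
  by (rule nth_equalityI) (auto simp: suffix_def add.assoc)

lemma factors_suffix: "factors (suffix k x) \<subseteq> factors x"
proof
  fix w assume "w \<in> factors (suffix k x)"
  then obtain i j where "i \<le> j" "w = subsequence x (k + i) (k + j)"
    by (auto simp: factors_def subsequence_suffix)
  then show "w \<in> factors x" by (simp add: subsequence_in_factors)
qed

lemma append_eq_subsequence: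
  assumes "u @ v = subsequence x i (i + length (u @ v))"
  shows "u = subsequence x i (i + length u)" "v = subsequence x (i + length u) (i + length u + length v)"
proof -
  have "u @ v = subsequence x i (i + length u) @ subsequence x (i + length u) (i + length u + length v)"
    using assms subsequence_split[of i "i + length u" "i + length u + length v" x] by (simp add: add.assoc)
  then show "u = subsequence x i (i + length u)" "v = subsequence x (i + length u) (i + length u + length v)"
    by (simp_all add: append_eq_append_conv)
qed

lemma factors_appendD:
  assumes "u @ v \<in> factors x"
  shows "u \<in> factors x" "v \<in> factors x"
proof -
  obtain i where "u @ v = subsequence x i (i + length (u @ v))"
    using assms by (auto simp only: factors_iff)
  then show "u \<in> factors x" "v \<in> factors x"
    using append_eq_subsequence[of u v x i] unfolding factors_iff by blast+
qed

lemma factors_snoc: "w \<in> factors x \<Longrightarrow> \<exists>d. w @ [d] \<in> factors x"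
proof -
  assume "w \<in> factors x"
  then obtain i where i: "w = subsequence x i (i + length w)" by (auto simp: factors_iff)
  have "subsequence x i (Suc (i + length w)) = w @ [x (i + length w)]"
    using i by (simp add: subsequence_def)
  then show ?thesis by (metis subsequence_in_factors le_add1 le_SucI)
qed

lemma subsequence_single: "subsequence x i (Suc i) = [x i]"
  by (simp add: subsequence_def)

lemma nth_in_factors: "[x i] \<in> factors x"
  by (metis subsequence_single subsequence_in_factors le_SucI order_refl)

text \<open>An image splits into blocks, the images of the letters; the block of the letter \<open>x m\<close>
  starts at the position \<open>length (apply_fin f (prefix m x))\<close>, and cutting there commutes with
  taking images.\<close>

lemma image_subsequence:
  assumes "apply_inf f x = Inf y" "m \<le> n"
  shows "subsequence y (length (apply_fin f (prefix m x))) (length (apply_fin f (prefix n x)))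
    = apply_fin f (subsequence x m n)"
proof -
  let ?l = "\<lambda>n. length (apply_fin f (prefix n x))"
  have p: "apply_fin f (prefix n x) = prefix (?l n) y" for n
    using assms(1) by (auto simp: apply_inf_eq_Inf_iff)
  have *: "apply_fin f (prefix n x) = apply_fin f (prefix m x) @ apply_fin f (subsequence x m n)"
    using assms(2) subsequence_split[of 0 m n x] by simp
  then have "?l m \<le> ?l n" by simp
  then have "prefix (?l n) y = prefix (?l m) y @ subsequence y (?l m) (?l n)"
    by (simp add: subsequence_split[of 0])
  with * p[of n] p[of m] show ?thesis by simp
qed

lemma image_suffix:
  assumes "apply_inf f x = Inf y"
  shows "apply_inf f (suffix m x) = Inf (suffix (length (apply_fin f (prefix m x))) y)"
proof -
  let ?l = "\<lambda>n. length (apply_fin f (prefix n x))"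
  have s: "prefix n (suffix m x) = subsequence x m (m + n)" for n
    by (simp add: subsequence_suffix)
  have len: "?l (m + n) = ?l m + length (apply_fin f (prefix n (suffix m x)))" for n
    using subsequence_split[of 0 m "m + n" x] by (simp add: s)
  have eq: "apply_fin f (prefix n (suffix m x))
      = prefix (length (apply_fin f (prefix n (suffix m x)))) (suffix (?l m) y)" for n
    using image_subsequence[OF assms, of m "m + n"] len[of n] by (simp add: s subsequence_suffix)
  have "\<exists>n. k < length (apply_fin f (prefix n (suffix m x)))" for k
  proof -
    obtain n where n: "k + ?l m < ?l n"
      using assms by (auto simp: apply_inf_eq_Inf_iff infinite_image_def)
    have "\<not> n \<le> m"
    proof
      assume "n \<le> m"
      then have "?l n \<le> ?l m" using subsequence_split[of 0 n m x] by simp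
      with n show False by simp
    qed
    then show ?thesis using n len[of "n - m"] by (intro exI[of _ "n - m"]) simp
  qed
  with eq show ?thesis by (simp add: apply_inf_eq_Inf_iff infinite_image_def)
qed

lemma image_in_factors:
  assumes "apply_inf f x = Inf y" "w \<in> factors x"
  shows "apply_fin f w \<in> factors y"
proof -
  obtain i j where ij: "i \<le> j" "w = subsequence x i j" using assms(2) by (auto simp: factors_def)
  have "length (apply_fin f (prefix i x)) \<le> length (apply_fin f (prefix j x))"
    using subsequence_split[of 0 i j x] ij by simp
  then show ?thesis using image_subsequence[OF assms(1) ij(1)] ij(2)
    by (metis subsequence_in_factors)
qed

text \<open>Together with the next lemma this makes images under a composition computable step by step
  from the image of the whole, without assuming that the intermediate images are infinite.\<close>

lemma apply_inf_comp_left: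
  assumes g: "apply_inf g x = Inf y" and fg: "apply_inf (comp_mor f g) x = Inf z"
  shows "apply_inf f y = Inf z"
proof -
  let ?l = "\<lambda>n. length (apply_fin g (prefix n x))"
  have gp: "apply_fin g (prefix n x) = prefix (?l n) y" for n
    using g by (auto simp: apply_inf_eq_Inf_iff)
  have comp: "apply_fin (comp_mor f g) (prefix n x) = apply_fin f (prefix (?l n) y)" for n
    using gp[of n] by (simp add: apply_fin_comp)
  have inf: "infinite_image f y"
    unfolding infinite_image_def
  proof
    fix k
    obtain n where "k < length (apply_fin (comp_mor f g) (prefix n x))"
      using fg by (auto simp: apply_inf_eq_Inf_iff infinite_image_def)
    then show "\<exists>n. k < length (apply_fin f (prefix n y))" unfolding comp by blast
  qed
  then obtain z' where z': "apply_inf f y = Inf z'" by (auto simp: apply_inf_def)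
  from apply_inf_comp[OF g z'] fg z' show ?thesis by simp
qed

text \<open>If the image under \<open>g\<close> were finite, then from some point on \<open>g\<close> would contribute only empty
  words, and the composition as well.\<close>

lemma apply_inf_comp_split:
  assumes "apply_inf (comp_mor f g) x = Inf z"
  shows "\<exists>y. apply_inf g x = Inf y \<and> apply_inf f y = Inf z"
proof -
  have "infinite_image g x"
  proof (rule ccontr)
    assume "\<not> infinite_image g x"
    then obtain B where B: "\<And>n. length (apply_fin g (prefix n x)) \<le> B"
      by (auto simp: infinite_image_def not_less)
    let ?l = "\<lambda>n. length (apply_fin g (prefix n x))"
    obtain m where m: "\<And>n. ?l n \<le> ?l m"
    proof -
      have "finite (range ?l)" using B unfolding finite_nat_set_iff_bounded_le by auto
      then have "Max (range ?l) \<in> range ?l" by (intro Max_in) auto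
      then obtain m where "?l m = Max (range ?l)" by auto
      with \<open>finite (range ?l)\<close> have "?l n \<le> ?l m" for n by simp
      then show thesis by (rule that)
    qed
    have "length (apply_fin (comp_mor f g) (prefix n x)) \<le> length (apply_fin (comp_mor f g) (prefix m x))" for n
    proof (cases "n \<le> m")
      case True
      then show ?thesis using subsequence_split[of 0 n m x] by simp
    next
      case False
      then have *: "prefix n x = prefix m x @ subsequence x m n" using subsequence_split[of 0 m n x] by simp
      with m[of n] have "apply_fin g (subsequence x m n) = []" by simp
      with * show ?thesis by (simp add: apply_fin_comp) (simp add: apply_fin_def)
    qed
    then show False using assms by (metis apply_inf_eq_Inf_iff infinite_image_def not_less)
  qed
  then obtain y where "apply_inf g x = Inf y" by (auto simp: apply_inf_def)
  with apply_inf_comp_left[OF this assms] show ?thesis by blast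
qed

lemma apply_inf_letters: "apply_inf (\<lambda>a. [h a]) x = Inf (h \<circ> x)"
proof -
  have "apply_fin (\<lambda>a. [h a]) w = map h w" for w by (induction w) (auto simp: apply_fin_def)
  then show ?thesis
    by (auto simp: apply_inf_eq_Inf_iff infinite_image_def subsequence_def)
qed

lemma factors_letters: "factors (h \<circ> x) = map h ` factors x"
proof -
  have "subsequence (h \<circ> x) i j = map h (subsequence x i j)" for i j
    by (simp add: subsequence_def)
  then show ?thesis by (auto simp: factors_def)
qed

lemma sturmian_letters:
  assumes "inj h"
  shows "sturmian (h \<circ> x) \<longleftrightarrow> sturmian x"
proof -
  have "{w \<in> factors (h \<circ> x). length w = n} = map h ` {w \<in> factors x. length w = n}" for n
    by (auto simp: factors_letters)
  then have "complexity (h \<circ> x) n = complexity x n" for n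
    unfolding complexity_def using assms by (simp add: card_image[OF inj_on_subset[OF inj_mapI[OF assms] subset_UNIV]])
  moreover have "range (h \<circ> x) = h ` range x" by auto
  then have "finite (range (h \<circ> x)) = finite (range x)"
    by (simp add: finite_image_iff inj_on_subset[OF assms subset_UNIV])
  ultimately show ?thesis by (simp add: sturmian_def)
qed

section \<open>Sturmian binary words and right special factors\<close>

definition right_special :: "bool word \<Rightarrow> bool list \<Rightarrow> bool" where
  "right_special x w \<longleftrightarrow> (\<forall>d. w @ [d] \<in> factors x)"

definition one_right_special :: "bool word \<Rightarrow> nat \<Rightarrow> bool" where
  "one_right_special x n \<longleftrightarrow> (\<exists>!w. length w = n \<and> right_special x w)"

lemma right_special_iff: "right_special x w \<longleftrightarrow> w @ [c] \<in> factors x \<and> w @ [\<not> c] \<in> factors x"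
  by (cases c) (auto simp: right_special_def all_bool_eq)

lemma right_special_factor: "right_special x w \<Longrightarrow> w \<in> factors x"
  unfolding right_special_def using factors_appendD(1) by blast

lemma right_special_appendD: "right_special x (u @ w) \<Longrightarrow> right_special x w"
  unfolding right_special_def using factors_appendD(2)[of u "w @ [_]" x] by simp

text \<open>A factor of length \<open>n\<close> has one or two extensions to the right, and two exactly when
  it is right special.\<close>

lemma complexity_Suc:
  fixes x :: "bool word"
  shows "complexity x (Suc n) = complexity x n + card {w. length w = n \<and> right_special x w}"
proof -
  let ?E = "\<lambda>d. {w. length w = n \<and> w @ [d] \<in> factors x}"
  have fin: "finite (?E d)" for d
    by (rule finite_subset[OF _ finite_lists_length_eq[of "UNIV :: bool set" n]]) auto
  have "{w \<in> factors x. length w = Suc n} = (\<Union>d. (\<lambda>w. w @ [d]) ` ?E d)"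
  proof
    show "{w \<in> factors x. length w = Suc n} \<subseteq> (\<Union>d. (\<lambda>w. w @ [d]) ` ?E d)"
    proof
      fix w assume w: "w \<in> {w \<in> factors x. length w = Suc n}"
      then obtain v d where "w = v @ [d]" by (cases w rule: rev_cases) auto
      with w show "w \<in> (\<Union>d. (\<lambda>w. w @ [d]) ` ?E d)" by auto
    qed
  qed auto
  also have "\<dots> = (\<lambda>w. w @ [True]) ` ?E True \<union> (\<lambda>w. w @ [False]) ` ?E False"
    by (simp add: UNIV_bool Un_commute)
  finally have "complexity x (Suc n)
      = card ((\<lambda>w. w @ [True]) ` ?E True \<union> (\<lambda>w. w @ [False]) ` ?E False)"
    by (simp add: complexity_def)
  also have "\<dots> = card ((\<lambda>w. w @ [True]) ` ?E True) + card ((\<lambda>w. w @ [False]) ` ?E False)"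
    by (rule card_Un_disjoint[OF finite_imageI[OF fin] finite_imageI[OF fin]]) blast
  also have "\<dots> = card (?E True) + card (?E False)"
    by (simp add: card_image inj_on_def)
  also have "\<dots> = card (?E True \<union> ?E False) + card (?E True \<inter> ?E False)"
    by (rule card_Un_Int[OF fin fin])
  also have "?E True \<union> ?E False = {w \<in> factors x. length w = n}"
  proof
    show "?E True \<union> ?E False \<subseteq> {w \<in> factors x. length w = n}"
      by (auto dest: factors_appendD(1))
    show "{w \<in> factors x. length w = n} \<subseteq> ?E True \<union> ?E False"
    proof
      fix w assume w: "w \<in> {w \<in> factors x. length w = n}"
      then obtain d where "w @ [d] \<in> factors x" using factors_snoc by blast
      with w show "w \<in> ?E True \<union> ?E False" by (cases d) auto
    qed
  qed
  also have "?E True \<inter> ?E False = {w. length w = n \<and> right_special x w}"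
    using right_special_iff[of x _ True] by auto
  finally show ?thesis by (simp add: complexity_def)
qed

lemma complexity_0: "complexity x 0 = 1"
proof -
  have "{w \<in> factors x. length w = 0} = {[]}"
    using subsequence_in_factors[of 0 0 x] by (auto simp: subsequence_def)
  then show ?thesis by (simp add: complexity_def)
qed

text \<open>The complexity is \<open>1\<close> at length \<open>0\<close> and grows from length \<open>n\<close> to \<open>n + 1\<close> by the number of right
  special factors of length \<open>n\<close>.\<close>

lemma sturmian_iff_one_right_special:
  "sturmian (x :: bool word) \<longleftrightarrow> (\<forall>n. one_right_special x n)"
proof -
  let ?R = "\<lambda>n. {w. length w = n \<and> right_special x w}"
  have "card A = 1 \<longleftrightarrow> (\<exists>!w. w \<in> A)" for A :: "bool list set"
    unfolding One_nat_def card_1_singleton_iff by blast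
  then have card1: "card (?R n) = 1 \<longleftrightarrow> one_right_special x n" for n
    by (simp add: one_right_special_def)
  have "(\<forall>n. complexity x n = n + 1) \<longleftrightarrow> (\<forall>n. card (?R n) = 1)"
  proof
    assume *: "\<forall>n. complexity x n = n + 1"
    show "\<forall>n. card (?R n) = 1"
    proof
      fix n show "card (?R n) = 1"
        using complexity_Suc[of x n] *[rule_format, of n] *[rule_format, of "Suc n"] by linarith
    qed
  next
    assume *: "\<forall>n. card (?R n) = 1"
    show "\<forall>n. complexity x n = n + 1"
    proof
      fix n show "complexity x n = n + 1"
      proof (induction n)
        case (Suc n)
        then show ?case using complexity_Suc[of x n] *[rule_format, of n] by linarith
      qed (simp add: complexity_0)
    qed
  qed
  moreover have "finite (range x)" by simp
  ultimately show ?thesis unfolding sturmian_def card1 by simp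
qed

lemma right_special_unique:
  "one_right_special x (length u) \<Longrightarrow> right_special x u \<Longrightarrow> right_special x v \<Longrightarrow>
    length u = length v \<Longrightarrow> u = v"
  unfolding one_right_special_def by metis

definition eventually_periodic :: "'a word \<Rightarrow> bool" where
  "eventually_periodic x \<longleftrightarrow> (\<exists>K p. p > 0 \<and> (\<forall>i\<ge>K. x (i + p) = x i))"

lemma eventually_periodic_suffix: "eventually_periodic (suffix k x) \<Longrightarrow> eventually_periodic x"
proof -
  assume "eventually_periodic (suffix k x)"
  then obtain K p where p: "p > 0" "\<And>i. i \<ge> K \<Longrightarrow> x (k + (i + p)) = x (k + i)"
    by (auto simp: eventually_periodic_def)
  have "x (i + p) = x i" if "i \<ge> k + K" for i
    using p(2)[of "i - k"] that by simp
  with p(1) show ?thesis unfolding eventually_periodic_def by blast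
qed

text \<open>Every factor of an eventually periodic word occurs within the preperiod and the first
  period, so the complexity is bounded.\<close>

lemma sturmian_aperiodic:
  assumes "sturmian x" shows "\<not> eventually_periodic x"
proof
  assume "eventually_periodic x"
  then obtain K p where p: "p > 0" "\<And>i. i \<ge> K \<Longrightarrow> x (i + p) = x i"
    by (auto simp: eventually_periodic_def)
  let ?N = "K + p"
  have shift: "\<exists>i'<?N. \<forall>j. x (i + j) = x (i' + j)" for i
  proof (induction i rule: less_induct)
    case (less i)
    show ?case
    proof (cases "i < ?N")
      case False
      then obtain i' where i': "i' < ?N" "\<forall>j. x (i - p + j) = x (i' + j)"
        using less[of "i - p"] p(1) by auto
      have "x (i + j) = x (i - p + j)" for j
        using p(2)[of "i - p + j"] False by (simp add: algebra_simps)
      with i' show ?thesis by auto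
    qed auto
  qed
  have "{w \<in> factors x. length w = ?N} \<subseteq> (\<lambda>i. subsequence x i (i + ?N)) ` {..<?N}"
  proof
    fix w assume "w \<in> {w \<in> factors x. length w = ?N}"
    then obtain i where i: "w = subsequence x i (i + ?N)" by (auto simp: factors_iff)
    obtain i' where i': "i' < ?N" "\<forall>j. x (i + j) = x (i' + j)" using shift by blast
    have "w = subsequence x i' (i' + ?N)" unfolding i by (rule nth_equalityI) (use i' in auto)
    with i' show "w \<in> (\<lambda>i. subsequence x i (i + ?N)) ` {..<?N}" by auto
  qed
  then have "complexity x ?N \<le> card {..<?N}"
    unfolding complexity_def by (rule surj_card_le[OF finite_lessThan])
  moreover have "complexity x ?N = ?N + 1" using assms by (simp add: sturmian_def)
  ultimately show False by simp
qed

text \<open>Without right special factors of length \<open>n\<close>, every block of length \<open>n\<close> determines the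
  rest of the word, and some block occurs twice.\<close>

lemma eventually_periodic_if_no_right_special:
  assumes "\<And>w. length w = n \<Longrightarrow> \<not> right_special x w"
  shows "eventually_periodic x"
proof -
  let ?b = "\<lambda>i. subsequence x i (i + n)"
  have "range ?b \<subseteq> {w. set w \<subseteq> (UNIV :: bool set) \<and> length w = n}" by auto
  then have "finite (range ?b)" using finite_lists_length_eq[OF finite] finite_subset by blast
  then have "\<not> inj ?b" using finite_imageD[of ?b UNIV] by auto
  then obtain i j where ij: "i < j" "?b i = ?b j"
    unfolding inj_def by (metis linorder_neqE_nat)
  have snoc: "subsequence x k (Suc (k + n)) = ?b k @ [x (k + n)]" for k
    by (simp add: subsequence_def)
  have next_letter: "x (k + n) = x (l + n)" if "?b k = ?b l" for k l
  proof (rule ccontr)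
    assume "x (k + n) \<noteq> x (l + n)"
    then have "x (l + n) = (\<not> x (k + n))" by auto
    moreover have "?b k @ [x (k + n)] \<in> factors x" "?b k @ [x (l + n)] \<in> factors x"
      using snoc[of k] snoc[of l] that by (metis subsequence_in_factors le_SucI le_add1)+
    ultimately have "right_special x (?b k)" by (simp add: right_special_iff[of _ _ "x (k + n)"])
    with assms show False by simp
  qed
  have blocks: "?b (i + m) = ?b (j + m)" for m
  proof (induction m)
    case (Suc m)
    have step: "?b (Suc k) = tl (?b k @ [x (k + n)])" for k
      by (rule nth_equalityI) (auto simp: nth_tl nth_append)
    show ?case using step[of "i + m"] step[of "j + m"] Suc next_letter[OF Suc] by simp
  qed (use ij in simp)
  have "x (k + (j - i)) = x k" if "k \<ge> i + n" for k
  proof -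
    have "x (j + (k - i - n) + n) = x (i + (k - i - n) + n)" using next_letter[OF blocks] by metis
    moreover have "j + (k - i - n) + n = k + (j - i)" "i + (k - i - n) + n = k" using that ij by auto
    ultimately show ?thesis by simp
  qed
  with ij show ?thesis unfolding eventually_periodic_def by (metis zero_less_diff)
qed

text \<open>A tail has no right special factors beyond those of the whole word, and it has some of every
  length because it is aperiodic.\<close>

lemma sturmian_suffix:
  fixes x :: "bool word"
  assumes "sturmian x" shows "sturmian (suffix k x)"
  unfolding sturmian_iff_one_right_special one_right_special_def
proof
  fix n
  have rs: "right_special x w" if "right_special (suffix k x) w" for w
    using that factors_suffix unfolding right_special_def by blast
  have "\<not> eventually_periodic (suffix k x)"
    using assms sturmian_aperiodic eventually_periodic_suffix by blast
  then obtain w where "length w = n" "right_special (suffix k x) w"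
    using eventually_periodic_if_no_right_special by blast
  with rs show "\<exists>!w. length w = n \<and> right_special (suffix k x) w"
    using assms right_special_unique unfolding sturmian_iff_one_right_special
    by (intro ex1I[of _ w]) metis+
qed

lemma sturmian_infinitely_often:
  fixes x :: "bool word"
  assumes "sturmian x" shows "\<exists>i\<ge>k. x i = d"
proof (rule ccontr)
  assume "\<not> ?thesis"
  then have "x i = (\<not> d)" if "i \<ge> k" for i using that by blast
  then have "eventually_periodic x"
    unfolding eventually_periodic_def by (intro exI[of _ k] exI[of _ 1]) simp
  with assms sturmian_aperiodic show False by blast
qed

text \<open>Here \<open>n\<close> is the length of the run of the other letter up to the next occurrence of \<open>p\<close>.\<close>

lemma return_factor:
  assumes "sturmian x" "x i = p"
  shows "\<exists>n. subsequence x i (i + n + 2) = p # replicate n (\<not> p) @ [p]"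
proof -
  let ?P = "\<lambda>m. x (i + m + 1) = p"
  obtain j where j: "j \<ge> i + 1" "x j = p" using sturmian_infinitely_often[OF assms(1)] by blast
  then have "?P (j - i - 1)" by simp
  then have ex: "\<exists>m. ?P m" by blast
  define n where "n = (LEAST m. ?P m)"
  have "?P n" unfolding n_def using ex by (rule LeastI_ex)
  have lt: "x (i + m + 1) = (\<not> p)" if "m < n" for m
    using not_less_Least[of m ?P] that unfolding n_def by blast
  have "subsequence x i (i + n + 2) = p # replicate n (\<not> p) @ [p]"
  proof (rule nth_equalityI)
    fix k assume "k < length (subsequence x i (i + n + 2))"
    then have k: "k < n + 2" by simp
    have "subsequence x i (i + n + 2) ! k = x (i + k)"
      using k by (simp add: subsequence_def del: upt_Suc)
    also have "\<dots> = (p # replicate n (\<not> p) @ [p]) ! k"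
    proof (cases k)
      case (Suc m)
      then show ?thesis using k lt[of m] \<open>?P n\<close> by (cases "m = n") (simp_all add: nth_append)
    qed (use assms in simp)
    finally show "subsequence x i (i + n + 2) ! k = (p # replicate n (\<not> p) @ [p]) ! k" .
  qed simp
  then show ?thesis ..
qed

text \<open>Exactly one letter \<open>c\<close> is right special. Its square occurs; the other letter is followed by \<open>c\<close>
  and therefore by nothing else.\<close>

lemma sturmian_length2:
  fixes x :: "bool word"
  assumes "sturmian x"
  shows "[d, \<not> d] \<in> factors x" "\<exists>c. [c, c] \<in> factors x \<and> [\<not> c, \<not> c] \<notin> factors x"
proof -
  have ne: "[d, \<not> d] \<in> factors x" for d
  proof -
    obtain i where "x i = (\<not> d)" using sturmian_infinitely_often[OF assms] by blast
    obtain j where j: "x j = d" using sturmian_infinitely_often[OF assms] by blast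
    let ?P = "\<lambda>m. x (j + m + 1) = (\<not> d)"
    obtain l where l: "l \<ge> j + 1" "x l = (\<not> d)" using sturmian_infinitely_often[OF assms] by blast
    then have "?P (l - j - 1)" by simp
    define n where "n = (LEAST m. ?P m)"
    have n: "?P n" unfolding n_def using \<open>?P (l - j - 1)\<close> by (rule LeastI)
    have "x (j + n) = d"
    proof (cases n)
      case (Suc m)
      then show ?thesis using not_less_Least[of m ?P] unfolding n_def by auto
    qed (use j in simp)
    with n have "subsequence x (j + n) (j + n + 2) = [d, \<not> d]" by (simp add: subsequence_def)
    then show ?thesis by (metis subsequence_in_factors le_add1)
  qed
  then show "[d, \<not> d] \<in> factors x" .
  from assms have o1: "one_right_special x 1" by (simp add: sturmian_iff_one_right_special)
  then obtain w where "length w = 1" "right_special x w" unfolding one_right_special_def by blast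
  then obtain c where c: "right_special x [c]" by (cases w) auto
  have "\<not> right_special x [\<not> c]" using right_special_unique[of x "[c]" "[\<not> c]"] o1 c by auto
  with ne[of "\<not> c"] have "[\<not> c, \<not> c] \<notin> factors x" by (auto simp: right_special_iff[of _ _ c])
  moreover have "[c, c] \<in> factors x" using c by (simp add: right_special_iff[of _ _ c])
  ultimately show "\<exists>c. [c, c] \<in> factors x \<and> [\<not> c, \<not> c] \<notin> factors x" by blast
qed

section \<open>The elementary Sturmian morphisms\<close>

definition lmor :: "bool \<Rightarrow> (bool, bool) morphism" where
  "lmor c d = (if d = c then [c] else [c, d])"

definition rmor :: "bool \<Rightarrow> (bool, bool) morphism" where
  "rmor c d = (if d = c then [c] else [d, c])"

abbreviation no_square :: "bool \<Rightarrow> bool list \<Rightarrow> bool" where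
  "no_square d \<equiv> successively (\<lambda>a b. \<not> (a = d \<and> b = d))"

lemma apply_fin_Nil [simp]: "apply_fin f [] = []"
  by (simp add: apply_fin_def)

lemma apply_fin_Cons [simp]: "apply_fin f (a # w) = f a @ apply_fin f w"
  by (simp add: apply_fin_def)

lemma lmor_simps [simp]: "lmor c c = [c]" "lmor c (\<not> c) = [c, \<not> c]" "lmor (\<not> c) c = [\<not> c, c]"
  by (simp_all add: lmor_def)

lemma rmor_simps [simp]: "rmor c c = [c]" "rmor c (\<not> c) = [\<not> c, c]" "rmor (\<not> c) c = [c, \<not> c]"
  by (simp_all add: rmor_def)

lemma bool_eq_or_neg: obtains "(d :: bool) = c" | "d = (\<not> c)"
  by blast

lemma lmor_Cons: "\<exists>t. lmor c d = c # t"
  by (cases rule: bool_eq_or_neg[of d c]) simp_all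

lemma lmor_start: "apply_fin (lmor c) w = [] \<and> w = [] \<or> (\<exists>t. apply_fin (lmor c) w = c # t)"
proof (cases w)
  case (Cons d v)
  then show ?thesis using lmor_Cons[of c d] by auto
qed simp

text \<open>Blocks of \<^term>\<open>lmor c\<close> can be recognised by their first letter. This conjugation carries
  over to \<^term>\<open>rmor c\<close> what is proved for \<^term>\<open>lmor c\<close>.\<close>

lemma lmor_rmor_conjugate: "apply_fin (lmor c) w @ [c] = c # apply_fin (rmor c) w"
proof (induction w)
  case (Cons d w)
  then show ?case by (cases rule: bool_eq_or_neg[of d c]) simp_all
qed simp

lemma no_squareD: "no_square d w \<Longrightarrow> w = p @ [d, d] @ s \<Longrightarrow> False"
  by (auto simp: successively_append_iff)

lemma no_square_factor:
  assumes "[d, d] \<notin> factors x" "w \<in> factors x"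
  shows "no_square d w"
  using assms(2)
proof (induction w)
  case (Cons a w)
  from Cons.prems have "w \<in> factors x" using factors_appendD(2)[of "[a]" w] by simp
  then have w: "no_square d w" by (rule Cons.IH)
  show ?case
  proof (cases w)
    case (Cons b v)
    have "[a, b] \<in> factors x" using Cons Cons.prems factors_appendD(1)[of "[a, b]" v] by simp
    have "\<not> (a = d \<and> b = d)"
    proof
      assume "a = d \<and> b = d"
      then have "a = d" "b = d" by blast+
      then have "[a, b] = [d, d]" by simp
      with \<open>[a, b] \<in> factors x\<close> assms(1) show False by metis
    qed
    with Cons w show ?thesis by simp
  qed simp
qed simp

lemma no_square_lmor: "no_square (\<not> c) (apply_fin (lmor c) w)"
proof (induction w)
  case (Cons d w)
  then show ?case using lmor_start[of c w]
    by (cases rule: bool_eq_or_neg[of d c]) (auto simp: successively_Cons)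
qed simp

lemma lmor_decode:
  assumes "no_square (\<not> c) u" "u = [] \<or> hd u = c"
  shows "\<exists>w. u = apply_fin (lmor c) w"
  using assms
proof (induction "length u" arbitrary: u rule: less_induct)
  case less
  show ?case
  proof (cases u)
    case (Cons a v)
    then have a: "a = c" using less.prems by simp
    show ?thesis
    proof (cases "v = [] \<or> hd v = c")
      case True
      then obtain w where "v = apply_fin (lmor c) w"
        using less.hyps[of v] less.prems Cons by (auto simp: successively_Cons)
      then have "u = apply_fin (lmor c) (c # w)" using Cons a by simp
      then show ?thesis ..
    next
      case False
      then obtain t where v: "v = (\<not> c) # t" by (cases v) auto
      have "t = [] \<or> hd t = c" using less.prems Cons v by (auto simp: successively_Cons)
      then obtain w where "t = apply_fin (lmor c) w"
        using less.hyps[of t] less.prems Cons v by (auto simp: successively_Cons)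
      then have "u = apply_fin (lmor c) ((\<not> c) # w)" using Cons a v by simp
      then show ?thesis ..
    qed
  qed (auto intro: exI[of _ "[]"])
qed

lemma lmor_decode_last:
  assumes "no_square (\<not> c) u" "u \<noteq> []" "hd u = c" "last u = c"
  shows "\<exists>w. u = apply_fin (lmor c) w @ [c]"
proof -
  define v where "v = butlast u"
  have v: "u = v @ [c]" using append_butlast_last_id[OF assms(2)] assms(4) by (simp add: v_def)
  have "v = [] \<or> hd v = c" using assms(3) v by (cases v) auto
  moreover have "no_square (\<not> c) v" using assms(1) v by (simp add: successively_append_iff)
  ultimately show ?thesis using lmor_decode v by blast
qed

lemma rmor_decode:
  assumes "no_square (\<not> c) u" "u = [] \<or> last u = c"
  shows "\<exists>w. u = apply_fin (rmor c) w"
proof -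
  have "no_square (\<not> c) (c # u)" using assms(1) by (cases u) auto
  then obtain w where "c # u = apply_fin (lmor c) w @ [c]"
    using lmor_decode_last[of c "c # u"] assms(2) by auto
  then show ?thesis unfolding lmor_rmor_conjugate by blast
qed

text \<open>In an image under \<^term>\<open>lmor c\<close> the letter \<open>c\<close> marks the starts of the blocks.\<close>

lemma lmor_split:
  "apply_fin (lmor c) u = p @ c # v \<Longrightarrow>
    \<exists>u1 u2. u = u1 @ u2 \<and> p = apply_fin (lmor c) u1 \<and> c # v = apply_fin (lmor c) u2"
proof (induction u arbitrary: p)
  case (Cons d u)
  show ?case
  proof (cases "p = []")
    case True
    then show ?thesis using Cons.prems by (intro exI[of _ "[]"] exI[of _ "d # u"]) simp
  next
    case False
    have "\<exists>q. p = lmor c d @ q \<and> apply_fin (lmor c) u = q @ c # v"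
    proof (cases rule: bool_eq_or_neg[of d c])
      case 1
      then show ?thesis using False Cons.prems by (cases p) auto
    next
      case 2
      then show ?thesis using False Cons.prems by (cases p; cases "tl p") auto
    qed
    then obtain q where q: "p = lmor c d @ q" "apply_fin (lmor c) u = q @ c # v" by blast
    from Cons.IH[OF q(2)] obtain u1 u2 where
      "u = u1 @ u2" "q = apply_fin (lmor c) u1" "c # v = apply_fin (lmor c) u2" by blast
    then show ?thesis using q(1) by (intro exI[of _ "d # u1"] exI[of _ u2]) simp
  qed
qed simp

lemma lmor_prefix_decode:
  "apply_fin (lmor c) u = apply_fin (lmor c) w @ [c, d] @ s \<Longrightarrow> \<exists>r. u = w @ [d] @ r"
proof (induction w arbitrary: u)
  case Nil
  then obtain e r where "u = e # r" by (cases u) auto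
  moreover then have "e = d"
    using Nil by (cases r) (auto simp: lmor_def split: if_splits)
  ultimately show ?case by simp
next
  case (Cons a w)
  obtain t where t: "apply_fin (lmor c) w @ [c, d] @ s = c # t"
    using lmor_start[of c w] by auto
  obtain e r where u: "u = e # r" using Cons.prems lmor_Cons[of c a] by (cases u) auto
  have eq: "lmor c e @ apply_fin (lmor c) r = lmor c a @ c # t"
    using Cons.prems unfolding u t[symmetric] by simp
  have "e = a"
    using eq lmor_start[of c r]
    by (cases rule: bool_eq_or_neg[of e c]; cases rule: bool_eq_or_neg[of a c]) auto
  with eq have "apply_fin (lmor c) r = apply_fin (lmor c) w @ [c, d] @ s" unfolding t by simp
  then show ?case using Cons.IH[of r] u \<open>e = a\<close> by auto
qed

lemma image_factor_covered:
  assumes "apply_inf f x = Inf y" "w \<in> factors y"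
  shows "\<exists>n p s. apply_fin f (prefix n x) = p @ w @ s"
proof -
  obtain i j where ij: "i \<le> j" "w = subsequence y i j" using assms(2) by (auto simp: factors_def)
  obtain n where n: "j < length (apply_fin f (prefix n x))"
    using assms(1) by (auto simp: apply_inf_eq_Inf_iff infinite_image_def)
  have "apply_fin f (prefix n x) = prefix (length (apply_fin f (prefix n x))) y"
    using assms(1) by (auto simp: apply_inf_eq_Inf_iff)
  also have "\<dots> = prefix i y @ w @ subsequence y j (length (apply_fin f (prefix n x)))"
    using n ij subsequence_split[of 0 i "length (apply_fin f (prefix n x))" y]
      subsequence_split[of i j "length (apply_fin f (prefix n x))" y] by simp
  finally show ?thesis by blast
qed

lemma prefix_in_factors: "prefix n x \<in> factors x"
  by (simp add: subsequence_in_factors)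

lemma lmor_no_square_image:
  assumes "apply_inf (lmor c) x = Inf y"
  shows "[\<not> c, \<not> c] \<notin> factors y"
  using image_factor_covered[OF assms] no_squareD[OF no_square_lmor] by metis

text \<open>Every block starts with \<open>c\<close>, and the letter after that \<open>c\<close> tells which block it is: it is \<open>\<not> c\<close> for
  the block of \<open>\<not> c\<close>, and otherwise the first letter \<open>c\<close> of the following block. Hence an occurrence
  of \<open>w d\<close> upstairs corresponds to one of \<open>L(w) c d\<close> in the image.\<close>

lemma lmor_factor_forward:
  assumes "apply_inf (lmor c) x = Inf y" "w @ [d] \<in> factors x"
  shows "apply_fin (lmor c) w @ [c, d] \<in> factors y"
proof (cases rule: bool_eq_or_neg[of d c])
  case 1
  obtain e where "(w @ [d]) @ [e] \<in> factors x" using factors_snoc[OF assms(2)] by blast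
  then have "apply_fin (lmor c) w @ [c] @ lmor c e \<in> factors y"
    using image_in_factors[OF assms(1)] 1 by force
  moreover obtain t where "lmor c e = [c] @ t" using lmor_Cons[of c e] by auto
  ultimately show ?thesis
    using factors_appendD(1)[of "apply_fin (lmor c) w @ [c, c]" t] 1 by simp
next
  case 2
  then show ?thesis using image_in_factors[OF assms] by simp
qed

lemma lmor_factor_backward:
  assumes "apply_inf (lmor c) x = Inf y" "apply_fin (lmor c) w @ [c, d] \<in> factors y"
  shows "w @ [d] \<in> factors x"
proof -
  obtain n p s where n: "apply_fin (lmor c) (prefix n x) = p @ (apply_fin (lmor c) w @ [c, d]) @ s"
    using image_factor_covered[OF assms] by blast
  obtain t where t: "(apply_fin (lmor c) w @ [c, d]) @ s = c # t"
    using lmor_start[of c w] by auto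
  obtain u1 u2 where u: "prefix n x = u1 @ u2" "c # t = apply_fin (lmor c) u2"
    using lmor_split n t by metis
  then obtain r where "u2 = w @ [d] @ r" using lmor_prefix_decode[of c u2 w d s] t by auto
  with u(1) have "u1 @ (w @ [d]) @ r \<in> factors x" using prefix_in_factors[of x n] by simp
  then show ?thesis using factors_appendD by blast
qed

lemma length_lmor: "length (apply_fin (lmor c) w) = length w + count_list w (\<not> c)"
  by (induction w) (auto simp: lmor_def)

lemma right_special_lmor:
  assumes "apply_inf (lmor c) x = Inf y" "right_special x w"
  shows "right_special y (apply_fin (lmor c) w @ [c])"
  using lmor_factor_forward[OF assms(1)] assms(2) unfolding right_special_def by simp

text \<open>A right special factor \<open>u\<close> of the image ends in \<open>c\<close>, since \<open>\<not> c\<close> is always followed by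
  \<open>c\<close>. If it starts with \<open>\<not> c\<close>, then every occurrence of it is preceded by \<open>c\<close>. Up to that
  letter it is therefore a product of blocks followed by \<open>c\<close>.\<close>

lemma right_special_lmor_preimage:
  assumes im: "apply_inf (lmor c) x = Inf y" and rs: "right_special y u" and "u \<noteq> []"
  shows "\<exists>w v. apply_fin (lmor c) w @ [c] = v @ u \<and> right_special x w \<and>
    length w < length u \<and> length u \<le> 2 * length w + 1"
proof -
  have nsq: "no_square (\<not> c) w" if "w \<in> factors y" for w
    using no_square_factor[OF lmor_no_square_image[OF im] that] .
  have "last u = c"
  proof (rule ccontr)
    assume "last u \<noteq> c"
    then have l: "last u = (\<not> c)" by blast
    have u: "butlast u @ [last u] = u" using \<open>u \<noteq> []\<close> by simp
    have "u @ [\<not> c] \<in> factors y" using rs by (simp add: right_special_def)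
    then have "(butlast u @ [last u]) @ [\<not> c] \<in> factors y" unfolding u .
    then have "butlast u @ [\<not> c, \<not> c] \<in> factors y" unfolding l by simp
    then show False using lmor_no_square_image[OF im] factors_appendD(2) by blast
  qed
  have y0: "y 0 = c"
  proof -
    have "subsequence y 0 (length (lmor c (x 0))) = lmor c (x 0)"
      using image_subsequence[OF im, of 0 1] by (simp add: subsequence_def)
    then show ?thesis by (auto simp: lmor_def subsequence_def split: if_splits)
  qed
  define v where "v = (if hd u = c then [] else [c])"
  have vu: "v @ u \<noteq> []" "hd (v @ u) = c" "last (v @ u) = c"
    using \<open>u \<noteq> []\<close> \<open>last u = c\<close> by (simp_all add: v_def)
  have rs': "(v @ u) @ [d] \<in> factors y" for d
  proof (cases "hd u = c")
    case False
    then obtain t where t: "u = (\<not> c) # t" using \<open>u \<noteq> []\<close> by (cases u) auto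
    have "u @ [d] \<in> factors y" using rs by (simp add: right_special_def)
    then obtain i where i: "u @ [d] = subsequence y i (i + length (u @ [d]))" unfolding factors_iff by blast
    have "(u @ [d]) ! 0 = y i" by (subst i) (simp add: subsequence_def del: upt_Suc)
    then have yi: "y i = (\<not> c)" using t by simp
    with y0 obtain j where j: "i = Suc j" by (cases i) auto
    have "y j = c"
    proof (rule ccontr)
      assume "y j \<noteq> c"
      then have "subsequence y j (j + 2) = [\<not> c, \<not> c]" using yi j by (simp add: subsequence_def)
      then show False using lmor_no_square_image[OF im] subsequence_in_factors[of j "j + 2" y] by simp
    qed
    have "subsequence y j (i + length (u @ [d])) = subsequence y j i @ subsequence y i (i + length (u @ [d]))"
      by (rule subsequence_split) (simp_all add: j)
    also have "\<dots> = c # (u @ [d])" using i \<open>y j = c\<close> by (simp add: j subsequence_single)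
    finally have "c # (u @ [d]) \<in> factors y"
      using subsequence_in_factors[of j "i + length (u @ [d])" y] by (simp add: j)
    then show ?thesis using False by (simp add: v_def)
  qed (use rs in \<open>simp add: v_def right_special_def\<close>)
  then have "v @ u \<in> factors y" using factors_appendD(1) by blast
  then obtain w where w: "v @ u = apply_fin (lmor c) w @ [c]"
    using lmor_decode_last[OF nsq vu] by blast
  have "right_special x w"
    using lmor_factor_backward[OF im] rs' unfolding w right_special_def by simp
  have len: "length v + length u = length w + count_list w (\<not> c) + 1"
    using arg_cong[OF w, of length] by (simp add: length_lmor)
  have le: "count_list w (\<not> c) \<le> length w" by (rule count_le_length)
  have lt: "length w < length u"
  proof (cases "hd u = c")
    case True
    then show ?thesis using len by (simp add: v_def)
  next
    case False
    then obtain t where t: "u = (\<not> c) # t" using \<open>u \<noteq> []\<close> by (cases u) auto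
    have "count_list w (\<not> c) \<noteq> 0"
    proof
      assume "count_list w (\<not> c) = 0"
      have "set w \<subseteq> {c}"
      proof
        fix a assume "a \<in> set w"
        then show "a \<in> {c}"
          using \<open>count_list w (\<not> c) = 0\<close>
          by (cases rule: bool_eq_or_neg[of a c]) (simp_all add: count_list_0_iff)
      qed
      then have "set (apply_fin (lmor c) w @ [c]) \<subseteq> {c}" by (auto simp: apply_fin_def lmor_def)
      then show False using w[symmetric] t by auto
    qed
    then show ?thesis using len False by (simp add: v_def)
  qed
  from w \<open>right_special x w\<close> lt len le show ?thesis
    by (intro exI[of _ w] exI[of _ v]) auto
qed

lemma one_right_special_0: "one_right_special x 0 \<longleftrightarrow> (\<forall>d. [d] \<in> factors x)"
  by (auto simp: one_right_special_def right_special_def)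

lemma right_special_drop:
  assumes "right_special x w" "n \<le> length w"
  shows "\<exists>v. length v = n \<and> right_special x v"
  using right_special_appendD[of x "take (length w - n) w" "drop (length w - n) w"] assms
  by (intro exI[of _ "drop (length w - n) w"]) simp

text \<open>Passing to the image makes right special factors longer, so that uniqueness is inherited
  level by level; this form also serves for words that are fixed by a morphism.\<close>

lemma one_right_special_lmor:
  assumes im: "apply_inf (lmor c) x = Inf y" and less: "\<And>m. m < n \<Longrightarrow> one_right_special x m"
    and "n > 0"
  shows "one_right_special y n"
proof -
  obtain w where "length w = n - 1" "right_special x w"
    using less[of "n - 1"] \<open>n > 0\<close> by (auto simp: one_right_special_def)
  then obtain u where u: "length u = n" "right_special y u"
    using right_special_drop[OF right_special_lmor[OF im], of w n] \<open>n > 0\<close> by (auto simp: length_lmor)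
  have uniq: "u1 = u2" if u1: "length u1 = n" "right_special y u1" and u2: "length u2 = n" "right_special y u2"
      and w1: "apply_fin (lmor c) w1 @ [c] = v1 @ u1" "right_special x w1"
      and w2: "apply_fin (lmor c) w2 @ [c] = v2 @ u2" "right_special x w2" and lt: "length w1 < n"
      and le: "length w1 \<le> length w2" for u1 u2 w1 w2 v1 v2
  proof -
    define t where "t = take (length w2 - length w1) w2"
    define v where "v = drop (length w2 - length w1) w2"
    have tv: "w2 = t @ v" "length v = length w1" using le by (simp_all add: t_def v_def)
    then have "right_special x v" using w2(2) right_special_appendD by blast
    then have "v = w1" using right_special_unique[OF less[OF lt] w1(2) \<open>right_special x v\<close>] tv(2) by simp
    with tv(1) w1(1) w2(1) have "v2 @ u2 = (apply_fin (lmor c) t @ v1) @ u1" by simp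
    then show ?thesis using u1(1) u2(1) by (metis append_eq_append_conv)
  qed
  have "u' = u" if u': "length u' = n" "right_special y u'" for u'
  proof -
    obtain w v where w: "apply_fin (lmor c) w @ [c] = v @ u" "right_special x w" "length w < n"
      using right_special_lmor_preimage[OF im u(2)] u(1) \<open>n > 0\<close> by auto
    obtain w' v' where w': "apply_fin (lmor c) w' @ [c] = v' @ u'" "right_special x w'" "length w' < n"
      using right_special_lmor_preimage[OF im u'(2)] u'(1) \<open>n > 0\<close> by auto
    show ?thesis
      using uniq[OF u u' w(1,2) w'(1,2) w(3)] uniq[OF u' u w'(1,2) w(1,2) w'(3)]
      by (cases "length w \<le> length w'") auto
  qed
  with u show ?thesis unfolding one_right_special_def by blast
qed

lemma one_right_special_0_lmor:
  assumes im: "apply_inf (lmor c) x = Inf y" and "one_right_special x 0"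
  shows "one_right_special y 0"
proof -
  have "[c, \<not> c] \<in> factors y"
    using lmor_factor_forward[OF im, of "[]" "\<not> c"] assms(2) by (simp add: one_right_special_0)
  then have "[c] \<in> factors y" "[\<not> c] \<in> factors y"
    using factors_appendD[of "[c]" "[\<not> c]" y] by simp_all
  then have "[d] \<in> factors y" for d by (cases rule: bool_eq_or_neg[of d c]) simp_all
  then show ?thesis by (simp add: one_right_special_0)
qed

lemma lmor_suffix_cancel:
  "length w = length w' \<Longrightarrow> apply_fin (lmor c) w = t @ apply_fin (lmor c) w' \<Longrightarrow> w = w'"
proof (induction w arbitrary: w' t rule: rev_induct)
  case (snoc d w)
  then obtain v e where v: "w' = v @ [e]" by (cases w' rule: rev_cases) auto
  have lst: "last (u @ lmor c a) = a" for u a by (simp add: lmor_def)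
  have "d = e" using snoc.prems(2) lst[of "apply_fin (lmor c) w" d] lst[of "t @ apply_fin (lmor c) v" e]
    unfolding v by simp
  then show ?case using snoc v by auto
qed simp

text \<open>For the converse, two right special factors \<open>w\<close>, \<open>w'\<close> of \<open>x\<close> of equal length yield right special
  factors \<open>L(w) c\<close> and \<open>L(w') c\<close> of the Sturmian image, so that one of these is a suffix of the other;
  since the last letter of a block determines the block, \<open>w = w'\<close>.\<close>

lemma sturmian_lmor:
  assumes im: "apply_inf (lmor c) x = Inf y"
  shows "sturmian y \<longleftrightarrow> sturmian x"
proof
  assume "sturmian x"
  then show "sturmian y"
    using one_right_special_lmor[OF im] one_right_special_0_lmor[OF im]
    unfolding sturmian_iff_one_right_special by (metis gr_zeroI)
next
  assume y: "sturmian y"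
  show "sturmian x"
    unfolding sturmian_iff_one_right_special
  proof
    fix n
    \<comment> \<open>Taking preimages at most halves the length, up to the extra letter \<open>c\<close>.\<close>
    obtain u where "length u = 2 * n + 2" "right_special y u"
      using y unfolding sturmian_iff_one_right_special one_right_special_def by metis
    moreover then have "u \<noteq> []" by auto
    ultimately obtain w where "right_special x w" "2 * n + 2 \<le> 2 * length w + 1"
      using right_special_lmor_preimage[OF im, of u] by metis
    then have "right_special x w" "n \<le> length w" by simp_all
    then obtain v where v: "length v = n" "right_special x v" using right_special_drop by blast
    have "v' = v" if v': "length v' = n" "right_special x v'" for v'
    proof -
      have *: "w1 = w2" if "length w1 = n" "right_special x w1" "length w2 = n" "right_special x w2"
        "length (apply_fin (lmor c) w2) \<le> length (apply_fin (lmor c) w1)" for w1 w2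
      proof -
        let ?u1 = "apply_fin (lmor c) w1 @ [c]" and ?u2 = "apply_fin (lmor c) w2 @ [c]"
        define k where "k = length ?u1 - length ?u2"
        have "right_special y (take k ?u1 @ drop k ?u1)"
          unfolding append_take_drop_id using right_special_lmor[OF im that(2)] .
        then have "right_special y (drop k ?u1)" by (rule right_special_appendD)
        moreover have "right_special y ?u2" using right_special_lmor[OF im that(4)] .
        ultimately have "drop k ?u1 = ?u2"
          using right_special_unique[of y ?u2 "drop k ?u1"] y that(5)
          unfolding sturmian_iff_one_right_special by (simp add: k_def)
        then have "?u1 = take k ?u1 @ ?u2" by (metis append_take_drop_id)
        moreover have "take k ?u1 = take k (apply_fin (lmor c) w1)" using that(5) by (simp add: k_def)
        ultimately have "apply_fin (lmor c) w1 = take k (apply_fin (lmor c) w1) @ apply_fin (lmor c) w2"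
          by simp
        then show ?thesis using lmor_suffix_cancel that(1,3) by metis
      qed
      show ?thesis
        using *[OF v v'] *[OF v' v]
        by (cases "length (apply_fin (lmor c) v') \<le> length (apply_fin (lmor c) v)") auto
    qed
    with v show "one_right_special x n" unfolding one_right_special_def by blast
  qed
qed

lemma apply_inf_nonerasing:
  assumes "\<And>a. f a \<noteq> []"
  shows "\<exists>y. apply_inf f x = Inf y"
proof -
  have len: "length w \<le> length (apply_fin f w)" for w
  proof (induction w)
    case (Cons a w)
    have "length (f a) \<noteq> 0" using assms by simp
    with Cons show ?case by (simp only: apply_fin_Cons length_append length_Cons)
  qed simp
  have "infinite_image f x" unfolding infinite_image_def
  proof
    fix k show "\<exists>n. k < length (apply_fin f (prefix n x))"
      using len[of "prefix (Suc k) x"] by (intro exI[of _ "Suc k"]) (simp del: upt_Suc)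
  qed
  then show ?thesis by (auto simp: apply_inf_def)
qed

lemma lmor_image_exists: "\<exists>y. apply_inf (lmor c) x = Inf y"
proof (rule apply_inf_nonerasing)
  show "lmor c a \<noteq> []" for a using lmor_Cons[of c a] by auto
qed

lemma rmor_image_eq_suffix:
  assumes l: "apply_inf (lmor c) x = Inf y" and r: "apply_inf (rmor c) x = Inf z"
  shows "z = suffix 1 y"
proof
  fix k
  obtain n where n: "k < length (apply_fin (rmor c) (prefix n x))"
    using r by (auto simp: apply_inf_eq_Inf_iff infinite_image_def)
  let ?L = "\<lambda>n. apply_fin (lmor c) (prefix n x)"
  have "apply_fin (rmor c) (prefix n x) = prefix (length (apply_fin (rmor c) (prefix n x))) z"
    using r by (auto simp: apply_inf_eq_Inf_iff)
  from arg_cong[OF this, of "\<lambda>w. w ! k"] n have "z k = apply_fin (rmor c) (prefix n x) ! k" by simp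
  also have "\<dots> = (?L n @ [c]) ! Suc k" unfolding lmor_rmor_conjugate by simp
  also have "\<dots> = y (Suc k)"
  proof -
    obtain t where t: "lmor c (x n) = c # t" using lmor_Cons by blast
    have L: "?L m = prefix (length (?L m)) y" for m using l by (auto simp: apply_inf_eq_Inf_iff)
    have "?L (Suc n) = (?L n @ [c]) @ t" using t by (simp add: subsequence_def)
    moreover have k: "Suc k < length (?L n @ [c])" unfolding lmor_rmor_conjugate using n by simp
    ultimately have "(?L n @ [c]) ! Suc k = ?L (Suc n) ! Suc k" "Suc k < length (?L (Suc n))"
      by (simp_all only: nth_append length_append if_True trans_less_add1)
    moreover have "?L (Suc n) ! Suc k = prefix (length (?L (Suc n))) y ! Suc k" using L by (rule arg_cong)
    ultimately show ?thesis by (simp add: subsequence_def del: upt_Suc)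
  qed
  finally show "z k = suffix 1 y k" by (simp add: suffix_def)
qed

lemma sturmian_rmor:
  assumes "apply_inf (rmor c) x = Inf z" "sturmian x"
  shows "sturmian z"
proof -
  obtain y where y: "apply_inf (lmor c) x = Inf y"
    using lmor_image_exists by blast
  with assms(2) have "sturmian y" by (simp add: sturmian_lmor)
  then show ?thesis using rmor_image_eq_suffix[OF y assms(1)] sturmian_suffix by blast
qed

lemma sturmian_tail_of_lmor:
  assumes im: "apply_inf (lmor c) x = Inf y" and "sturmian (suffix k y)"
  shows "\<exists>k. sturmian (suffix k x)"
proof -
  let ?l = "\<lambda>n. length (apply_fin (lmor c) (prefix n x))"
  obtain n where n: "k < ?l n"
    using im by (auto simp: apply_inf_eq_Inf_iff infinite_image_def)
  have "suffix (?l n) y = suffix (?l n - k) (suffix k y)" using n by (simp add: suffix_def add.assoc[symmetric])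
  then have "sturmian (suffix (?l n) y)" using sturmian_suffix[OF assms(2)] by simp
  with sturmian_lmor[OF image_suffix[OF im]] show ?thesis by blast
qed

text \<open>A Sturmian image under \<^term>\<open>rmor c\<close> does not force \<open>x\<close> itself to be Sturmian: if \<open>x\<close> is \<open>c\<close> followed by \<open>u\<close>,
  then the image of \<open>x\<close> is the image of \<open>u\<close> under \<^term>\<open>lmor c\<close>, which puts no constraint on the letter
  in front of \<open>u\<close>.\<close>

lemma sturmian_tail_of_rmor:
  assumes "apply_inf (rmor c) x = Inf z" "sturmian z"
  shows "\<exists>k. sturmian (suffix k x)"
proof -
  obtain y where y: "apply_inf (lmor c) x = Inf y"
    using lmor_image_exists by blast
  show ?thesis using sturmian_tail_of_lmor[OF y] rmor_image_eq_suffix[OF y assms(1)] assms(2) by blast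
qed

section \<open>Sturmian morphisms\<close>

text \<open>The monoid generated by the exchange of the letters and the elementary morphisms. It turns out to
  consist of exactly those morphisms that send some Sturmian word to a Sturmian word, and then they
  send all Sturmian words to Sturmian words.\<close>

inductive sturmian_mor :: "(bool, bool) morphism \<Rightarrow> bool" where
  ident: "sturmian_mor (\<lambda>b. [b])"
| swap: "sturmian_mor (\<lambda>b. [\<not> b])"
| lmor: "sturmian_mor g \<Longrightarrow> sturmian_mor (comp_mor (lmor c) g)"
| rmor: "sturmian_mor g \<Longrightarrow> sturmian_mor (comp_mor (rmor c) g)"

lemma rmor_Cons: "\<exists>t. rmor c d = t @ [c]"
  by (cases rule: bool_eq_or_neg[of d c]) simp_all

lemma apply_fin_rmor_last: "w \<noteq> [] \<Longrightarrow> \<exists>t. apply_fin (rmor c) w = t @ [c]"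
proof (cases w rule: rev_cases)
  case (snoc v d)
  then show ?thesis using rmor_Cons[of c d] by auto
qed simp

lemma apply_fin_lmor_hd: "w \<noteq> [] \<Longrightarrow> \<exists>t. apply_fin (lmor c) w = c # t"
  using lmor_start[of c w] by auto

lemma sturmian_mor_nonempty: "sturmian_mor g \<Longrightarrow> g b \<noteq> []"
proof (induction rule: sturmian_mor.induct)
  case (lmor g c)
  then show ?case using apply_fin_lmor_hd[of "g b" c] by (auto simp: comp_mor_def)
next
  case (rmor g c)
  then show ?case using apply_fin_rmor_last[of "g b" c] by (auto simp: comp_mor_def)
qed auto

lemma rmor_image_exists: "\<exists>y. apply_inf (rmor c) x = Inf y"
proof (rule apply_inf_nonerasing)
  show "rmor c a \<noteq> []" for a using rmor_Cons[of c a] by auto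
qed

lemma sturmian_mor_preserves:
  "sturmian_mor g \<Longrightarrow> sturmian x \<Longrightarrow> \<exists>y. apply_inf g x = Inf y \<and> sturmian y"
proof (induction rule: sturmian_mor.induct)
  case ident
  then show ?case using apply_inf_letters[of "\<lambda>b. b" x] by (auto simp: comp_def)
next
  case swap
  have "inj Not" by (auto simp: inj_def)
  with swap show ?case using apply_inf_letters[of Not x] sturmian_letters[of Not x] by auto
next
  case (lmor g c)
  then obtain y where y: "apply_inf g x = Inf y" "sturmian y" by blast
  obtain z where "apply_inf (lmor c) y = Inf z" using lmor_image_exists by blast
  with y show ?case using apply_inf_comp[OF y(1)] sturmian_lmor by blast
next
  case (rmor g c)
  then obtain y where y: "apply_inf g x = Inf y" "sturmian y" by blast
  obtain z where "apply_inf (rmor c) y = Inf z" using rmor_image_exists by blast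
  with y show ?case using apply_inf_comp[OF y(1)] sturmian_rmor by blast
qed

text \<open>An elementary morphism applied last puts its own letter at one end of every nonempty image.\<close>

lemma sturmian_mor_common_end:
  assumes "sturmian_mor g"
  shows "g = (\<lambda>b. [b]) \<or> g = (\<lambda>b. [\<not> b]) \<or> (\<exists>c. \<forall>b. \<exists>u. g b = c # u) \<or> (\<exists>c. \<forall>b. \<exists>u. g b = u @ [c])"
  using assms
proof cases
  case (lmor h c)
  then have "\<exists>u. g b = c # u" for b
    using apply_fin_lmor_hd[OF sturmian_mor_nonempty[of h b], of c] by (simp add: comp_mor_def)
  then show ?thesis by blast
next
  case (rmor h c)
  then have "\<exists>u. g b = u @ [c]" for b
    using apply_fin_rmor_last[OF sturmian_mor_nonempty[of h b], of c] by (simp add: comp_mor_def)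
  then show ?thesis by blast
qed simp_all

text \<open>The images of \<open>p (\<not> p)\<close> and \<open>(\<not> p) p\<close> differ by one exchange of adjacent letters. This persists
  under composition, because \<^term>\<open>lmor c\<close> and \<^term>\<open>rmor c\<close> map \<open>e (\<not> e)\<close> and \<open>(\<not> e) e\<close>, up to a
  common letter \<open>c\<close> at one end, to themselves.\<close>

lemma sturmian_mor_differ:
  "sturmian_mor g \<Longrightarrow> \<exists>P e s. g p @ g (\<not> p) = P @ [e, \<not> e] @ s \<and> g (\<not> p) @ g p = P @ [\<not> e, e] @ s"
proof (induction rule: sturmian_mor.induct)
  case ident
  then show ?case by (intro exI[of _ "[]"] exI[of _ p]) simp
next
  case swap
  then show ?case by (intro exI[of _ "[]"] exI[of _ "\<not> p"]) simp
next
  case (lmor g c)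
  then obtain P e s where *: "g p @ g (\<not> p) = P @ [e, \<not> e] @ s" "g (\<not> p) @ g p = P @ [\<not> e, e] @ s"
    by blast
  let ?L = "apply_fin (lmor c)"
  have L: "?L [e, \<not> e] = c # [e, \<not> e]" "?L [\<not> e, e] = c # [\<not> e, e]"
    by (cases rule: bool_eq_or_neg[of e c]; simp)+
  have "?L (g p) @ ?L (g (\<not> p)) = (?L P @ [c]) @ [e, \<not> e] @ ?L s"
    "?L (g (\<not> p)) @ ?L (g p) = (?L P @ [c]) @ [\<not> e, e] @ ?L s"
    unfolding apply_fin_append[symmetric] * unfolding apply_fin_append L by simp_all
  then show ?case unfolding comp_mor_def by blast
next
  case (rmor g c)
  then obtain P e s where *: "g p @ g (\<not> p) = P @ [e, \<not> e] @ s" "g (\<not> p) @ g p = P @ [\<not> e, e] @ s"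
    by blast
  let ?L = "apply_fin (rmor c)"
  have L: "?L [e, \<not> e] = [e, \<not> e, c]" "?L [\<not> e, e] = [\<not> e, e, c]"
    by (cases rule: bool_eq_or_neg[of e c]; simp)+
  have "?L (g p) @ ?L (g (\<not> p)) = ?L P @ [e, \<not> e] @ (c # ?L s)"
    "?L (g (\<not> p)) @ ?L (g p) = ?L P @ [\<not> e, e] @ (c # ?L s)"
    unfolding apply_fin_append[symmetric] * unfolding apply_fin_append L by simp_all
  then show ?case unfolding comp_mor_def by blast
qed

text \<open>The minor of the incidence matrix that belongs to the columns \<open>a\<close> and \<open>b\<close>.\<close>

definition det_mor :: "('a \<Rightarrow> bool list) \<Rightarrow> 'a \<Rightarrow> 'a \<Rightarrow> int" where
  "det_mor h a b = int (count_list (h a) False) * int (count_list (h b) True)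
    - int (count_list (h a) True) * int (count_list (h b) False)"

lemma count_list_lmor:
  "count_list (apply_fin (lmor c) w) d
    = (if d = c then count_list w True + count_list w False else count_list w d)"
  by (induction w; cases c; cases d) (auto simp: lmor_def)

lemma count_list_rmor: "count_list (apply_fin (rmor c) w) d = count_list (apply_fin (lmor c) w) d"
  using arg_cong[OF lmor_rmor_conjugate[of c w], of "\<lambda>w. count_list w d"] by (cases "c = d") simp_all

text \<open>Composing with an elementary morphism on the left adds one row of the incidence matrix to the
  other.\<close>

lemma sturmian_mor_det: "sturmian_mor g \<Longrightarrow> \<bar>det_mor g False True\<bar> = 1"
proof (induction rule: sturmian_mor.induct)
  case (lmor g c)
  have "det_mor (comp_mor (lmor c) g) False True = det_mor g False True"
    by (cases c) (simp_all add: det_mor_def comp_mor_def count_list_lmor algebra_simps)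
  with lmor show ?case by simp
next
  case (rmor g c)
  have "det_mor (comp_mor (rmor c) g) False True = det_mor g False True"
    by (cases c) (simp_all add: det_mor_def comp_mor_def count_list_rmor count_list_lmor algebra_simps)
  with rmor show ?case by simp
qed (simp_all add: det_mor_def)

section \<open>Existence of Sturmian words\<close>

text \<open>The square of the Fibonacci morphism \<open>0 \<mapsto> 01\<close>, \<open>1 \<mapsto> 0\<close>, which is a product of two elementary
  morphisms.\<close>

definition fib :: "(bool, bool) morphism" where
  "fib = comp_mor (lmor False) (lmor True)"

lemma fib_simps [simp]: "fib False = [False, True, False]" "fib True = [False, True]"
  by (simp_all add: fib_def comp_mor_def lmor_def)

definition fib_prefix :: "nat \<Rightarrow> bool list" where
  "fib_prefix n = (apply_fin fib ^^ n) [False]"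

lemma fib_prefix_Suc: "fib_prefix (Suc n) = apply_fin fib (fib_prefix n)"
  by (simp add: fib_prefix_def)

lemma fib_prefix_extends: "\<exists>r. fib_prefix (Suc n) = fib_prefix n @ r"
proof (induction n)
  case (Suc n)
  then obtain r where "fib_prefix (Suc n) = fib_prefix n @ r" by blast
  then have "fib_prefix (Suc (Suc n)) = fib_prefix (Suc n) @ apply_fin fib r"
    using fib_prefix_Suc[of "Suc n"] fib_prefix_Suc[of n] by simp
  then show ?case ..
qed (simp add: fib_prefix_def)

lemma fib_prefix_extends_le: "m \<le> n \<Longrightarrow> \<exists>r. fib_prefix n = fib_prefix m @ r"
proof (induction n rule: dec_induct)
  case (step n)
  then show ?case using fib_prefix_extends[of n] by auto
qed simp

lemma length_fib_prefix: "n < length (fib_prefix n)"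
proof (induction n)
  case (Suc n)
  have "2 * length w \<le> length (apply_fin fib w)" for w
  proof (induction w)
    case (Cons a w)
    then show ?case by (cases a) simp_all
  qed simp
  from this[of "fib_prefix n"] Suc show ?case unfolding fib_prefix_Suc by linarith
qed (simp add: fib_prefix_def)

definition fib_word :: "bool word" where
  "fib_word k = fib_prefix k ! k"

lemma fib_word_prefix: "fib_prefix n = prefix (length (fib_prefix n)) fib_word"
proof (rule nth_equalityI)
  fix k assume k: "k < length (fib_prefix n)"
  have "fib_prefix n ! k = fib_prefix k ! k"
  proof (cases "k \<le> n")
    case True
    then obtain r where "fib_prefix n = fib_prefix k @ r" using fib_prefix_extends_le by blast
    then show ?thesis using length_fib_prefix[of k] by (simp add: nth_append)
  next
    case False
    then obtain r where "fib_prefix k = fib_prefix n @ r" using fib_prefix_extends_le[of n k] by auto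
    then show ?thesis using k by (simp add: nth_append)
  qed
  then show "fib_prefix n ! k = prefix (length (fib_prefix n)) fib_word ! k"
    using k by (simp add: fib_word_def)
qed simp

lemma fib_word_fixed: "apply_inf fib fib_word = Inf fib_word"
proof -
  have ne: "fib a \<noteq> []" for a by (cases a) simp_all
  obtain z where "apply_inf fib fib_word = Inf z" using apply_inf_nonerasing[of fib] ne by blast
  then have "infinite_image fib fib_word" by (simp add: apply_inf_eq_Inf_iff)
  moreover have "apply_fin fib (prefix n fib_word)
      = prefix (length (apply_fin fib (prefix n fib_word))) fib_word" for n
  proof -
    let ?N = "\<lambda>n. length (fib_prefix n)"
    have "fib_prefix n = prefix n fib_word @ subsequence fib_word n (?N n)"
      using fib_word_prefix[of n] subsequence_split[of 0 n "?N n" fib_word] length_fib_prefix[of n] by simp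
    then have "fib_prefix (Suc n) = apply_fin fib (prefix n fib_word) @ apply_fin fib (subsequence fib_word n (?N n))"
      using fib_prefix_Suc[of n] by (metis apply_fin_append)
    then have "apply_fin fib (prefix n fib_word) @ apply_fin fib (subsequence fib_word n (?N n))
        = prefix (?N (Suc n)) fib_word" using fib_word_prefix[of "Suc n"] by simp
    then have "apply_fin fib (prefix n fib_word) @ apply_fin fib (subsequence fib_word n (?N n))
        = subsequence fib_word 0 (0 + length (apply_fin fib (prefix n fib_word) @ apply_fin fib (subsequence fib_word n (?N n))))"
      by (metis add_0 diff_zero subsequence_length)
    from append_eq_subsequence(1)[OF this] show ?thesis by simp
  qed
  ultimately show ?thesis by (simp add: apply_inf_eq_Inf_iff)
qed

text \<open>The fixed word and its image under \<^term>\<open>lmor True\<close> are images of each other under elementary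
  morphisms. Each of them therefore inherits a unique right special factor of length \<open>n\<close> from the
  right special factors of smaller length of the other one.\<close>

lemma sturmian_fib_word: "sturmian fib_word"
proof -
  obtain y where y: "apply_inf (lmor True) fib_word = Inf y" "apply_inf (lmor False) y = Inf fib_word"
    using apply_inf_comp_split[of "lmor False" "lmor True"] fib_word_fixed unfolding fib_def by blast
  have "one_right_special fib_word n \<and> one_right_special y n" for n
  proof (induction n rule: less_induct)
    case (less n)
    show ?case
    proof (cases "n = 0")
      case True
      have "fib_prefix 1 \<in> factors fib_word" using fib_word_prefix[of 1] prefix_in_factors by metis
      then have "[False, True, False] \<in> factors fib_word" by (simp add: fib_prefix_def)
      then have "[False] \<in> factors fib_word" "[True] \<in> factors fib_word"
        using factors_appendD[of "[False]" "[True, False]" fib_word]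
          factors_appendD(1)[of "[True]" "[False]" fib_word] by simp_all
      then have "one_right_special fib_word 0" by (simp add: one_right_special_0 all_bool_eq)
      with one_right_special_0_lmor[OF y(1)] True show ?thesis by simp
    next
      case False
      then show ?thesis using one_right_special_lmor[OF y(1), of n] one_right_special_lmor[OF y(2), of n] less
        by simp
    qed
  qed
  then show ?thesis by (simp add: sturmian_iff_one_right_special)
qed

section \<open>Locally Sturmian morphisms are Sturmian\<close>

definition locally_sturmian :: "(bool, bool) morphism \<Rightarrow> bool" where
  "locally_sturmian g \<longleftrightarrow> (\<exists>x y. sturmian x \<and> apply_inf g x = Inf y \<and> sturmian y)"

text \<open>Lets desubstitution work with words of which only a tail is known to be Sturmian.\<close>

lemma locally_sturmian_tail:
  assumes "sturmian x" "apply_inf g x = Inf y" "sturmian (suffix k y)"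
  shows "locally_sturmian g"
proof -
  let ?l = "\<lambda>n. length (apply_fin g (prefix n x))"
  obtain n where n: "k < ?l n"
    using assms(2) by (auto simp: apply_inf_eq_Inf_iff infinite_image_def)
  have "suffix (?l n) y = suffix (?l n - k) (suffix k y)" using n by (simp add: suffix_def add.assoc[symmetric])
  then have "sturmian (suffix (?l n) y)" using sturmian_suffix[OF assms(3)] by simp
  with image_suffix[OF assms(2)] sturmian_suffix[OF assms(1)] show ?thesis
    unfolding locally_sturmian_def by blast
qed

lemma locally_sturmian_lmor:
  assumes "locally_sturmian (comp_mor (lmor c) g)" shows "locally_sturmian g"
proof -
  obtain x z where x: "sturmian x" "apply_inf (comp_mor (lmor c) g) x = Inf z" "sturmian z"
    using assms unfolding locally_sturmian_def by blast
  then obtain y where "apply_inf g x = Inf y" "apply_inf (lmor c) y = Inf z"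
    using apply_inf_comp_split by blast
  with x show ?thesis unfolding locally_sturmian_def using sturmian_lmor by blast
qed

lemma locally_sturmian_rmor:
  assumes "locally_sturmian (comp_mor (rmor c) g)" shows "locally_sturmian g"
proof -
  obtain x z where x: "sturmian x" "apply_inf (comp_mor (rmor c) g) x = Inf z" "sturmian z"
    using assms unfolding locally_sturmian_def by blast
  then obtain y where y: "apply_inf g x = Inf y" "apply_inf (rmor c) y = Inf z"
    using apply_inf_comp_split by blast
  then obtain k where "sturmian (suffix k y)" using sturmian_tail_of_rmor x(3) by blast
  with x y show ?thesis using locally_sturmian_tail by blast
qed

text \<open>The case \<open>m = 0\<close> is that of an erased letter; with \<open>v\<close> a single letter the lemma says that both
  letters occur in the images of a locally Sturmian morphism.\<close>

lemma eventually_periodic_image_of_powers: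
  assumes im: "apply_inf g x = Inf y" and pow: "\<And>b. \<exists>m. g b = concat (replicate m v)"
  shows "eventually_periodic y"
proof -
  have fin: "\<exists>m. apply_fin g w = concat (replicate m v)" for w
  proof (induction w)
    case Nil
    show ?case by (intro exI[of _ 0]) simp
  next
    case (Cons b w)
    obtain m n where "g b = concat (replicate m v)" "apply_fin g w = concat (replicate n v)"
      using Cons pow by blast
    then show ?case by (intro exI[of _ "m + n"]) (simp add: replicate_add)
  qed
  have pre: "\<exists>m. k < length (concat (replicate m v)) \<and>
      concat (replicate m v) = prefix (length (concat (replicate m v))) y" for k
  proof -
    obtain n where n: "k < length (apply_fin g (prefix n x))"
      using im by (auto simp: apply_inf_eq_Inf_iff infinite_image_def)
    obtain m where m: "apply_fin g (prefix n x) = concat (replicate m v)" using fin by blast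
    have "apply_fin g (prefix n x) = prefix (length (apply_fin g (prefix n x))) y"
      using im by (auto simp: apply_inf_eq_Inf_iff)
    with n m show ?thesis by (intro exI[of _ m]) simp
  qed
  have "v \<noteq> []"
  proof
    assume "v = []"
    then have "concat (replicate m v) = []" for m by simp
    with pre[of 0] show False by simp
  qed
  have "y (k + length v) = y k" for k
  proof -
    obtain m where m: "k + length v < length (concat (replicate m v))"
      "concat (replicate m v) = prefix (length (concat (replicate m v))) y"
      using pre[of "k + length v"] by blast
    have nth: "concat (replicate m v) ! l = y l" if "l < length (concat (replicate m v))" for l
      using arg_cong[OF m(2), of "\<lambda>w. w ! l"] that by simp
    obtain m' where m': "m = Suc m'" using m(1) by (cases m) auto
    let ?u = "concat (replicate m' v)"
    have e1: "concat (replicate m v) = v @ ?u" by (simp add: m')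
    have e2: "concat (replicate m v) = ?u @ v"
      unfolding m' replicate_Suc replicate_append_same[symmetric] by simp
    have "k < length ?u" using m(1) unfolding e1 by simp
    have "y (k + length v) = (v @ ?u) ! (k + length v)" using nth[of "k + length v"] m(1) e1 by simp
    also have "\<dots> = ?u ! k" by (simp add: nth_append)
    also have "\<dots> = (?u @ v) ! k" using \<open>k < length ?u\<close> by (simp add: nth_append)
    also have "\<dots> = y k" using nth[of k] m(1) e2 by simp
    finally show ?thesis .
  qed
  with \<open>v \<noteq> []\<close> show ?thesis unfolding eventually_periodic_def
    by (intro exI[of _ 0] exI[of _ "length v"]) simp
qed

lemma locally_sturmian_nonempty:
  assumes "locally_sturmian g" shows "g b \<noteq> []"
proof
  assume b: "g b = []"
  obtain x y where x: "sturmian x" "apply_inf g x = Inf y" "sturmian y"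
    using assms unfolding locally_sturmian_def by blast
  have "\<exists>m. g a = concat (replicate m (g (\<not> b)))" for a
  proof (cases rule: bool_eq_or_neg[of a b])
    case 1
    then show ?thesis using b by (intro exI[of _ 0]) simp
  next
    case 2
    then show ?thesis by (intro exI[of _ 1]) simp
  qed
  then have "eventually_periodic y" using eventually_periodic_image_of_powers x(2) by blast
  with x(3) sturmian_aperiodic show False by blast
qed

text \<open>If \<open>j\<close> were larger, then \<open>(\<not> c) c\<^sup>i\<close> and \<open>c\<^sup>i\<^sup>+\<^sup>1\<close> would be two right special factors of the same
  length.\<close>

lemma sturmian_runs:
  fixes y :: "bool word"
  assumes "sturmian y" "(\<not> c) # replicate i c @ [\<not> c] \<in> factors y"
    "(\<not> c) # replicate j c @ [\<not> c] \<in> factors y"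
  shows "j \<le> i + 1"
proof (rule ccontr)
  assume "\<not> j \<le> i + 1"
  then obtain k where k: "j = k + (i + 2)" by (metis le_add_diff_inverse2 not_less_eq_eq Suc_eq_plus1 add_2_eq_Suc')
  have comm: "replicate n c @ c # w = c # replicate n c @ w" for n w
    by (induction n) simp_all
  have "((\<not> c) # replicate i c @ [c]) @ (c # replicate k c @ [\<not> c]) \<in> factors y"
    using assms(3) by (simp add: k replicate_add comm add.commute[of k])
  then have "(\<not> c) # replicate i c @ [c] \<in> factors y" by (rule factors_appendD(1))
  with assms(2) have "right_special y ((\<not> c) # replicate i c)" by (simp add: right_special_iff[of _ _ c])
  moreover have "((\<not> c) # replicate k c) @ (replicate (i + 1) c @ [c]) @ [\<not> c] \<in> factors y"
    "((\<not> c) # replicate (k + 1) c) @ (replicate (i + 1) c @ [\<not> c]) \<in> factors y"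
    using assms(3) by (simp_all add: k replicate_add comm)
  then have "replicate (i + 1) c @ [c] \<in> factors y" "replicate (i + 1) c @ [\<not> c] \<in> factors y"
    using factors_appendD by blast+
  then have "right_special y (replicate (i + 1) c)" by (simp add: right_special_iff[of _ _ c])
  ultimately have "(\<not> c) # replicate i c = replicate (i + 1) c"
    using right_special_unique[of y "(\<not> c) # replicate i c" "replicate (i + 1) c"] assms(1)
    unfolding sturmian_iff_one_right_special by simp
  then show False by simp
qed

lemma no_letter_replicate: "p \<notin> set w \<Longrightarrow> w = replicate (length w) (\<not> p)"
proof (induction w)
  case (Cons a w)
  then show ?case by (cases rule: bool_eq_or_neg[of a p]) simp_all
qed simp

text \<open>Take one run, of length \<open>m\<close>, and a sufficiently long right special factor \<open>w\<close>. If \<open>w\<close> contains \<open>p\<close>,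
  then the part of \<open>w\<close> from the last \<open>p\<close> on is right special, so the run that begins there can both
  stop and continue. Otherwise \<open>w\<close> is part of a run longer than \<open>m\<close>; it is longer than some
  position \<open>i0\<close> of \<open>p\<close>, so that some \<open>p\<close> precedes it.\<close>

lemma sturmian_two_runs:
  fixes x :: "bool word"
  assumes "sturmian x"
  shows "\<exists>m n. m < n \<and> p # replicate m (\<not> p) @ [p] \<in> factors x \<and> p # replicate n (\<not> p) @ [p] \<in> factors x"
proof -
  let ?q = "\<not> p"
  have run_at: "\<exists>n. subsequence x i (i + n + 2) = p # replicate n ?q @ [p]" if "x i = p" for i
    using return_factor[OF assms that] .
  \<comment> \<open>A run of length at least \<open>j\<close> after \<open>p\<close> is completed to a full one.\<close>
  have complete: "\<exists>n\<ge>j. p # replicate n ?q @ [p] \<in> factors x" if run: "p # replicate j ?q \<in> factors x" for j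
  proof -
    obtain i where i: "p # replicate j ?q = subsequence x i (i + length (p # replicate j ?q))"
      using run unfolding factors_iff by blast
    have nth: "x (i + k) = (p # replicate j ?q) ! k" if "k < j + 1" for k
      using that by (subst i) (simp add: subsequence_def del: upt_Suc)
    from nth[of 0] obtain n where n: "subsequence x i (i + n + 2) = p # replicate n ?q @ [p]"
      using run_at[of i] by auto
    have "n \<ge> j"
    proof (rule ccontr)
      assume "\<not> n \<ge> j"
      then have "x (i + (n + 1)) = ?q" using nth[of "n + 1"] by simp
      moreover have "x (i + (n + 1)) = subsequence x i (i + n + 2) ! (n + 1)"
        by (simp add: subsequence_def del: upt_Suc)
      then have "x (i + (n + 1)) = p" unfolding n by (simp add: nth_append)
      ultimately show False by blast
    qed
    with n show ?thesis using subsequence_in_factors[of i "i + n + 2" x] by auto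
  qed
  obtain i0 where i0: "x i0 = p" using sturmian_infinitely_often[OF assms] by blast
  obtain m where m: "p # replicate m ?q @ [p] \<in> factors x"
    using run_at[OF i0] subsequence_in_factors by (metis le_add1 add.assoc)
  have "(\<exists>j>m. p # replicate j ?q \<in> factors x) \<or> (\<exists>n. n \<noteq> m \<and> p # replicate n ?q @ [p] \<in> factors x)"
  proof -
    obtain w where w: "length w = i0 + m + 2" "right_special x w"
      using assms unfolding sturmian_iff_one_right_special one_right_special_def by blast
    show ?thesis
    proof (cases "p \<in> set w")
      case True
      then obtain u v where uv: "w = u @ p # v" "p \<notin> set v" using split_list_last by metis
      define n where "n = length v"
      have v: "v = replicate n ?q" using no_letter_replicate[OF uv(2)] by (simp add: n_def)
      have "right_special x (p # replicate n ?q)"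
        using w(2) right_special_appendD[of x u "p # v"] unfolding uv(1) v by simp
      then have "p # replicate n ?q @ [p] \<in> factors x" "p # replicate n ?q @ [?q] \<in> factors x"
        by (simp_all add: right_special_iff[of _ _ p])
      then have "p # replicate n ?q @ [p] \<in> factors x" "p # replicate (n + 1) ?q \<in> factors x"
        by (simp_all add: replicate_append_same)
      then show ?thesis by (cases "n = m") (auto intro: exI[of _ n] exI[of _ "n + 1"])
    next
      case False
      have "w = replicate (i0 + m + 2) ?q" using no_letter_replicate[OF False] w(1) by simp
      moreover have "w \<in> factors x" using right_special_factor[OF w(2)] .
      ultimately obtain s where s: "w = subsequence x s (s + length w)" unfolding factors_iff by blast
      have nth: "x (s + k) = ?q" if "k < length w" for k
      proof -
        have "w ! k = x (s + k)" using that by (subst s) (simp add: subsequence_def del: upt_Suc)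
        moreover have "w ! k = ?q" using that w(1) \<open>w = replicate (i0 + m + 2) ?q\<close> by (metis nth_replicate)
        ultimately show ?thesis by simp
      qed
      have "i0 < s"
      proof (rule ccontr)
        assume "\<not> i0 < s"
        then have "i0 - s < length w" "s + (i0 - s) = i0" unfolding w(1) by simp_all
        with nth[of "i0 - s"] i0 show False by simp
      qed
      \<comment> \<open>The last occurrence of \<open>p\<close> before this block starts a run that contains it.\<close>
      define j where "j = Max {k. k < s \<and> x k = p}"
      have fin: "finite {k. k < s \<and> x k = p}" by simp
      have "j \<in> {k. k < s \<and> x k = p}" unfolding j_def using fin i0 \<open>i0 < s\<close> by (intro Max_in) auto
      then have j: "j < s" "x j = p" by auto
      have jmax: "k \<le> j" if "k < s" "x k = p" for k unfolding j_def using fin that by simp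
      have q: "x (j + k) = ?q" if k: "0 < k" "k \<le> m + 1" for k
      proof (cases "j + k < s")
        case True
        then show ?thesis using jmax[of "j + k"] k by auto
      next
        case False
        then show ?thesis using nth[of "j + k - s"] k w(1) j(1) by simp
      qed
      have "subsequence x j (j + (m + 2)) = p # replicate (m + 1) ?q"
      proof (rule nth_equalityI)
        fix k assume "k < length (subsequence x j (j + (m + 2)))"
        then have k: "k < m + 2" by simp
        have "subsequence x j (j + (m + 2)) ! k = x (j + k)" using k by (simp add: subsequence_def del: upt_Suc)
        also have "\<dots> = (p # replicate (m + 1) ?q) ! k"
        proof (cases k)
          case (Suc k')
          then have "(p # replicate (m + 1) ?q) ! k = ?q" using k by (simp del: replicate_Suc)
          then show ?thesis using q[of k] k Suc by simp
        qed (use j in simp)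
        finally show "subsequence x j (j + (m + 2)) ! k = (p # replicate (m + 1) ?q) ! k" .
      qed simp
      then have "p # replicate (m + 1) ?q \<in> factors x"
        using subsequence_in_factors[of j "j + (m + 2)" x] by simp
      then show ?thesis by (intro disjI1 exI[of _ "m + 1"]) simp
    qed
  qed
  then show ?thesis
  proof (elim disjE exE conjE)
    fix j assume "m < j" "p # replicate j ?q \<in> factors x"
    then obtain n where "n \<ge> j" "p # replicate n ?q @ [p] \<in> factors x" using complete by blast
    with m \<open>m < j\<close> show ?thesis by (intro exI[of _ m] exI[of _ n]) simp
  next
    fix n assume "n \<noteq> m" "p # replicate n ?q @ [p] \<in> factors x"
    with m show ?thesis using linorder_neq_iff[of n m] by blast
  qed
qed

text \<open>The preimage has one letter for each occurrence of \<open>q\<close>, namely the letter that follows this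
  occurrence. In the proof \<open>e m\<close> is the position of the \<open>m\<close>-th occurrence.\<close>

lemma lmor_image_preimage:
  fixes x :: "bool word"
  assumes "x 0 = q" "[\<not> q, \<not> q] \<notin> factors x"
  shows "\<exists>x'. apply_inf (lmor q) x' = Inf x"
proof -
  define e where "e = rec_nat 0 (\<lambda>_ k. k + length (lmor q (x (k + 1))))"
  have e0: "e 0 = 0" by (simp add: e_def)
  have eS: "e (Suc m) = e m + length (lmor q (x (e m + 1)))" for m by (simp add: e_def)
  define x' where "x' m = x (e m + 1)" for m
  have inv: "x (e m) = q \<and> subsequence x (e m) (e (Suc m)) = lmor q (x' m) \<and> x (e (Suc m)) = q"
    if "x (e m) = q" for m
  proof (cases rule: bool_eq_or_neg[of "x' m" q])
    case 1
    then have "e (Suc m) = e m + 1" by (simp add: eS x'_def)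
    with 1 that show ?thesis by (simp add: x'_def subsequence_def)
  next
    case 2
    then have e: "e (Suc m) = e m + 2" by (simp add: eS x'_def)
    have "x (e m + 2) = q"
    proof (rule ccontr)
      assume "x (e m + 2) \<noteq> q"
      then have "x (e m + 2) = (\<not> q)" by blast
      with 2 have "subsequence x (e m + 1) (e m + 3) = [\<not> q, \<not> q]"
        by (simp add: x'_def subsequence_def numeral_3_eq_3)
      then show False using assms(2) subsequence_in_factors[of "e m + 1" "e m + 3" x] by simp
    qed
    with 2 that e show ?thesis by (simp add: x'_def subsequence_def)
  qed
  have start: "x (e m) = q" for m
    by (induction m) (use assms(1) inv in \<open>simp_all add: e0\<close>)
  have pre: "apply_fin (lmor q) (prefix m x') = prefix (e m) x" for m
  proof (induction m)
    case (Suc m)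
    have "prefix (Suc m) x' = prefix m x' @ [x' m]" by (simp add: subsequence_def)
    then have "apply_fin (lmor q) (prefix (Suc m) x') = prefix (e m) x @ subsequence x (e m) (e (Suc m))"
      using Suc inv[OF start[of m]] by simp
    also have "\<dots> = prefix (e (Suc m)) x" using subsequence_split[of 0 "e m" "e (Suc m)" x] by (simp add: eS)
    finally show ?case .
  qed (simp add: e0 subsequence_def)
  obtain z where "apply_inf (lmor q) x' = Inf z" using lmor_image_exists by blast
  then have "infinite_image (lmor q) x'" by (simp add: apply_inf_eq_Inf_iff)
  with pre show ?thesis by (intro exI[of _ x']) (simp add: apply_inf_eq_Inf_iff)
qed

lemma count_list_both: "count_list w True + count_list w False = length w"
  by (induction w) auto

lemma length_eq_counts: "length w = count_list w c + count_list w (\<not> c)"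
  using count_list_both[of w] by (cases c) simp_all

lemma count_lmor_same: "count_list (apply_fin (lmor c) w) c = length w"
  by (simp add: count_list_lmor count_list_both)

lemma count_lmor_other: "count_list (apply_fin (lmor c) w) (\<not> c) = count_list w (\<not> c)"
  by (cases c) (simp_all add: count_list_lmor)

lemma length_rmor: "length (apply_fin (rmor c) w) = length (apply_fin (lmor c) w)"
  using arg_cong[OF lmor_rmor_conjugate[of c w], of length] by simp

lemma last_lmor: "w \<noteq> [] \<Longrightarrow> last (apply_fin (lmor c) w) = last w"
proof (cases w rule: rev_cases)
  case (snoc v d)
  then show ?thesis by (cases rule: bool_eq_or_neg[of d c]) simp_all
qed simp

lemma hd_lmor_preimage:
  assumes "apply_fin (lmor c) w = c # (\<not> c) # r" shows "\<exists>v. w = (\<not> c) # v"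
proof (cases w)
  case (Cons e v)
  have "e = (\<not> c)"
  proof (rule ccontr)
    assume "e \<noteq> (\<not> c)"
    then have "e = c" by blast
    then have "apply_fin (lmor c) v = (\<not> c) # r" using assms Cons by simp
    then show False using lmor_start[of c v] by auto
  qed
  with Cons show ?thesis by blast
qed (use assms in simp)

lemma ends_with: "w \<noteq> [] \<Longrightarrow> last w = a \<Longrightarrow> \<exists>u. w = u @ [a]"
  by (cases w rule: rev_cases) simp_all

lemma starts_with: "w \<noteq> [] \<Longrightarrow> hd w = a \<Longrightarrow> \<exists>u. w = a # u"
  by (cases w) simp_all

lemma image_no_square:
  fixes x y :: "bool word"
  assumes "sturmian x" "apply_inf g x = Inf y" "[d, d] \<notin> factors y"
  shows "no_square d (g b)"
proof -
  obtain i where "x i = b" using sturmian_infinitely_often[OF assms(1)] by blast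
  then have "[b] \<in> factors x" using nth_in_factors[of x i] by simp
  from image_in_factors[OF assms(2) this] show ?thesis using no_square_factor[OF assms(3)] by simp
qed

text \<open>With \<open>q = \<not> p\<close>, the composite \<open>G\<close> has \<open>G p = g q g p\<close> and \<open>G q = g q\<close>. The products \<open>G p G q\<close> and
  \<open>G q G p\<close> agree on the prefix \<open>g q\<close>, differ right after it, and differ in their last letters. As they
  differ by one exchange of adjacent letters only, just two letters follow the prefix, and these
  are \<open>g p g q\<close>.\<close>

lemma sturmian_mor_comp_lmor_letters:
  assumes G: "sturmian_mor (comp_mor g (lmor (\<not> p)))"
    and ne: "g p \<noteq> []" "g (\<not> p) \<noteq> []"
    and hd: "hd (g p) \<noteq> hd (g (\<not> p))" and last: "last (g p) \<noteq> last (g (\<not> p))"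
  shows "length (g p) = 1 \<and> length (g (\<not> p)) = 1"
proof -
  let ?G = "comp_mor g (lmor (\<not> p))" and ?k = "length (g (\<not> p))"
  let ?A = "g (\<not> p) @ g p @ g (\<not> p)" and ?B = "g (\<not> p) @ g (\<not> p) @ g p"
  have "?G p = g (\<not> p) @ g p" "?G (\<not> p) = g (\<not> p)"
    by (simp_all add: comp_mor_def)
  then obtain P e s where A: "?A = P @ [e, \<not> e] @ s" and B: "?B = P @ [\<not> e, e] @ s"
    using sturmian_mor_differ[OF G, of p] by auto
  have "s = []"
  proof (rule ccontr)
    assume "s \<noteq> []"
    then have "last ?A = last ?B" unfolding A B by simp
    with last ne show False by simp
  qed
  have "\<not> ?k < length P"
  proof
    assume "?k < length P"
    then have "?A ! ?k = ?B ! ?k" unfolding A B by (simp add: nth_append)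
    then show False using hd ne by (simp add: nth_append hd_conv_nth)
  qed
  moreover have "length ?A = length P + 2" using A \<open>s = []\<close> by simp
  ultimately have "?k + length (g p) \<le> 2" by simp
  moreover have "length (g p) \<noteq> 0" "?k \<noteq> 0" using ne by simp_all
  ultimately show ?thesis by linarith
qed

lemma sturmian_mor_of_letters:
  assumes "length (g p) = 1" "length (g (\<not> p)) = 1" "hd (g p) \<noteq> hd (g (\<not> p))"
  shows "sturmian_mor g"
proof -
  obtain a b where ab: "g p = [a]" "g (\<not> p) = [b]"
    using assms(1,2) by (metis One_nat_def length_0_conv length_Suc_conv)
  with assms(3) have "b = (\<not> a)" by auto
  have "g = (\<lambda>b. [b]) \<or> g = (\<lambda>b. [\<not> b])"
  proof (cases rule: bool_eq_or_neg[of a p])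
    case 1
    have "g d = [d]" for d
      by (cases rule: bool_eq_or_neg[of d p]) (use ab \<open>b = (\<not> a)\<close> 1 in simp_all)
    then show ?thesis by blast
  next
    case 2
    have "g d = [\<not> d]" for d
      by (cases rule: bool_eq_or_neg[of d p]) (use ab \<open>b = (\<not> a)\<close> 2 in simp_all)
    then show ?thesis by blast
  qed
  then show ?thesis using sturmian_mor.ident sturmian_mor.swap by metis
qed

text \<open>The case in which no elementary morphism splits off on the left. A detour makes the images
  longer before they become shorter: as \<open>p\<close> is isolated in \<open>x\<close>, a tail of \<open>x\<close> is an image under
  \<^term>\<open>lmor (\<not> p)\<close>, and \<open>g\<close> composed with this morphism gives images with the common first letter
  \<open>c\<close>. Splitting off one or two elementary morphisms from the composite leaves a morphism that is
  shorter than \<open>g\<close>. So the composite is Sturmian, and the previous lemmas show that \<open>g\<close> is a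
  bijection of the letters.\<close>

lemma locally_sturmian_no_common_end:
  assumes x: "sturmian x" and im: "apply_inf g x = Inf y" and y: "sturmian y"
    and dd: "[\<not> c, \<not> c] \<notin> factors y" and pp: "[p, p] \<notin> factors x"
    and gp: "hd (g p) = (\<not> c)" "last (g p) = (\<not> c)"
    and gq: "hd (g (\<not> p)) = c" "last (g (\<not> p)) = c"
    and ne: "\<And>b. g b \<noteq> []"
    and IH: "\<And>h. length (h p) + length (h (\<not> p)) < length (g p) + length (g (\<not> p)) \<Longrightarrow>
      locally_sturmian h \<Longrightarrow> sturmian_mor h"
  shows "sturmian_mor g"
proof (cases "length (g p) = 1 \<and> length (g (\<not> p)) = 1")
  case True
  then show ?thesis using sturmian_mor_of_letters[of g p] gp gq by simp
next
  case False
  let ?q = "\<not> p" and ?d = "\<not> c"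
  have cnt: "length w = count_list w c + count_list w ?d" for w by (rule length_eq_counts)
  \<comment> \<open>Starting at a letter \<open>q\<close>, the word \<open>x\<close> is an image under \<^term>\<open>lmor (\<not> p)\<close>.\<close>
  obtain n where n: "x n = ?q" using sturmian_infinitely_often[OF x] by blast
  define x1 where "x1 = suffix n x"
  define y1 where "y1 = suffix (length (apply_fin g (prefix n x))) y"
  have im1: "apply_inf g x1 = Inf y1" unfolding x1_def y1_def by (rule image_suffix[OF im])
  have x1: "sturmian x1" unfolding x1_def by (rule sturmian_suffix[OF x])
  have y1: "sturmian y1" unfolding y1_def by (rule sturmian_suffix[OF y])
  have dd1: "[?d, ?d] \<notin> factors y1" using dd factors_suffix unfolding y1_def by blast
  have pp1: "[\<not> ?q, \<not> ?q] \<notin> factors x1" using pp factors_suffix unfolding x1_def not_not by blast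
  have "x1 0 = ?q" using n by (simp add: x1_def suffix_def)
  from lmor_image_preimage[OF this pp1] obtain x2 where x2: "apply_inf (lmor ?q) x2 = Inf x1" ..
  then have sx2: "sturmian x2" using sturmian_lmor x1 by blast
  define G where "G = comp_mor g (lmor ?q)"
  have imG: "apply_inf G x2 = Inf y1" unfolding G_def by (rule apply_inf_comp[OF x2 im1])
  have Gq: "G ?q = g ?q" and Gp: "G p = g ?q @ g p" by (simp_all add: G_def comp_mor_def)
  have "\<exists>w. G b = apply_fin (lmor c) w" for b
  proof (rule lmor_decode)
    show "no_square ?d (G b)" using image_no_square[OF sx2 imG dd1] .
    show "G b = [] \<or> hd (G b) = c"
      using Gq Gp gq ne by (cases rule: bool_eq_or_neg[of b p]) simp_all
  qed
  then obtain G1 where G1: "\<And>b. G b = apply_fin (lmor c) (G1 b)" by metis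
  have G_eq: "G = comp_mor (lmor c) G1" by (rule ext) (simp add: comp_mor_def G1)
  obtain y2 where y2: "apply_inf G1 x2 = Inf y2" "apply_inf (lmor c) y2 = Inf y1"
    using imG apply_inf_comp_split unfolding G_eq by blast
  then have sy2: "sturmian y2" using sturmian_lmor y1 by blast
  have len1: "length (G1 b) = count_list (G b) c" for b by (simp add: G1 count_lmor_same)
  have cnt1: "count_list (G1 b) ?d = count_list (G b) ?d" for b by (simp add: G1 count_lmor_other)
  have qq: "[?q, ?q] \<in> factors x"
  proof -
    obtain a where a: "[a, a] \<in> factors x" using sturmian_length2(2)[OF x] by blast
    then show ?thesis using pp by (cases rule: bool_eq_or_neg[of a p]) auto
  qed
  obtain u where u: "g p = u @ [?d]" using ends_with[OF ne gp(2)] by blast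
  obtain v where v: "g p = ?d # v" using starts_with[OF ne gp(1)] by blast
  have "sturmian_mor G"
  proof (cases "?d \<in> set (g ?q)")
    case False
    \<comment> \<open>The lengths of the runs of \<open>c\<close> in \<open>y\<close> that come from runs of \<open>q\<close> in \<open>x\<close> are multiples of
      \<open>k\<close>, hence \<open>k = 1\<close>.\<close>
    define k where "k = length (g ?q)"
    have gqk: "g ?q = replicate k c" using no_letter_replicate[OF False] by (simp add: k_def)
    have pow: "apply_fin g (replicate m ?q) = replicate (m * k) c" for m
      by (induction m) (simp_all add: gqk replicate_add)
    have run: "?d # replicate (m * k) c @ [?d] \<in> factors y"
      if "p # replicate m ?q @ [p] \<in> factors x" for m
    proof -
      have "g p @ apply_fin g (replicate m ?q) @ g p \<in> factors y"
        using image_in_factors[OF im that] by simp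
      then have "(u @ [?d]) @ replicate (m * k) c @ (?d # v) \<in> factors y"
        by (simp only: pow u[symmetric] v[symmetric])
      then have "u @ (?d # replicate (m * k) c @ [?d]) @ v \<in> factors y" by simp
      then show ?thesis using factors_appendD by blast
    qed
    obtain m m' where m: "m < m'" "p # replicate m ?q @ [p] \<in> factors x" "p # replicate m' ?q @ [p] \<in> factors x"
      using sturmian_two_runs[OF x] by blast
    have "m' * k \<le> m * k + 1" using sturmian_runs[OF y run[OF m(2)] run[OF m(3)]] .
    moreover have "m' * k \<ge> (m + 1) * k" using m(1) by (intro mult_le_mono1) simp
    moreover have "k \<noteq> 0" using ne[of ?q] by (simp add: k_def)
    ultimately have "k = 1" by (simp add: add_mult_distrib)
    then have gq1: "g ?q = [c]" by (simp add: gqk)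
    with \<open>\<not> (length (g p) = 1 \<and> length (g ?q) = 1)\<close> have "length (g p) \<noteq> 1" by simp
    then obtain v' where "v = v' @ [?d]" using u v by (cases v rule: rev_cases) auto
    then have "count_list (g p) ?d \<ge> 2" using v by simp
    moreover have "length (G1 ?q) = 1" by (simp add: len1 Gq gq1)
    moreover have "length (G1 p) = 1 + count_list (g p) c" by (simp add: len1 Gp gq1)
    ultimately have "length (G1 p) + length (G1 ?q) < length (g p) + length (g ?q)"
      using cnt[of "g p"] gq1 by simp
    then have "sturmian_mor G1"
      using IH sx2 y2(1) sy2 unfolding locally_sturmian_def by blast
    then show ?thesis unfolding G_eq by (rule sturmian_mor.lmor)
  next
    case True
    \<comment> \<open>The images \<open>g q g p\<close> and \<open>g q g q\<close> contain runs of \<open>c\<close> whose lengths differ by the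
      length \<open>s\<close> of the first run of \<open>g q\<close>; hence \<open>s = 1\<close>, and a second elementary morphism
      splits off.\<close>
    obtain a r where ar: "g ?q = a @ ?d # r" "?d \<notin> set a" using split_list_first[OF True] by blast
    define s where "s = length a"
    have a: "a = replicate s c" using no_letter_replicate[OF ar(2)] by (simp add: s_def)
    obtain r' z where rz: "g ?q = r' @ ?d # z" "?d \<notin> set z" using split_list_last[OF True] by blast
    define t where "t = length z"
    have z: "z = replicate t c" using no_letter_replicate[OF rz(2)] by (simp add: t_def)
    have "s \<noteq> 0" using gq(1) ar(1) a by (cases s) auto
    have "g ?q @ g p \<in> factors y" using image_in_factors[OF im, of "[?q, p]"] sturmian_length2(1)[OF x, of ?q] by simp
    then have "r' @ (?d # replicate t c @ [?d]) @ v \<in> factors y" unfolding rz(1) z v by simp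
    then have run1: "?d # replicate t c @ [?d] \<in> factors y" using factors_appendD by blast
    have "g ?q @ g ?q \<in> factors y" using image_in_factors[OF im qq] by simp
    moreover have "g ?q @ g ?q = (r' @ ?d # z) @ (a @ ?d # r)"
      using arg_cong2[OF rz(1) ar(1), of "(@)"] .
    ultimately have "(r' @ ?d # z) @ (a @ ?d # r) \<in> factors y" by (simp only:)
    then have "r' @ (?d # replicate (t + s) c @ [?d]) @ r \<in> factors y"
      unfolding z a by (simp add: replicate_add)
    then have run2: "?d # replicate (t + s) c @ [?d] \<in> factors y" using factors_appendD by blast
    have "s = 1" using sturmian_runs[OF y run1 run2] \<open>s \<noteq> 0\<close> by simp
    then have gqd: "g ?q = c # ?d # r" using ar(1) a by simp
    have hdq: "\<exists>w. G1 ?q = ?d # w"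
      by (rule hd_lmor_preimage[of c _ r]) (simp add: G1[symmetric] Gq gqd)
    have hdp: "\<exists>w. G1 p = ?d # w"
      by (rule hd_lmor_preimage[of c _ "r @ g p"]) (simp add: G1[symmetric] Gp gqd)
    have ne1: "G1 p \<noteq> []" using hdp by auto
    have l1: "last (G1 p) = ?d"
      using last_lmor[OF ne1, of c] unfolding G1[symmetric] Gp using gp(2) ne[of p] by simp
    obtain u1 where u1: "G1 p = u1 @ [?d]" using ends_with[OF ne1 l1] by blast
    obtain v1 where v1: "G1 ?q = ?d # v1" using hdq by blast
    have "G1 p @ G1 ?q \<in> factors y2"
      using image_in_factors[OF y2(1), of "[p, ?q]"] sturmian_length2(1)[OF sx2, of p] by simp
    then have "u1 @ [?d, ?d] @ v1 \<in> factors y2" unfolding u1 v1 by simp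
    then have "[?d, ?d] \<in> factors y2" using factors_appendD by blast
    have cc: "[\<not> ?d, \<not> ?d] \<notin> factors y2"
    proof -
      obtain b where b: "[b, b] \<in> factors y2" "[\<not> b, \<not> b] \<notin> factors y2"
        using sturmian_length2(2)[OF sy2] by blast
      show ?thesis
      proof (cases rule: bool_eq_or_neg[of b c])
        case 1
        then show ?thesis using b(2) \<open>[?d, ?d] \<in> factors y2\<close> by simp
      next
        case 2
        then show ?thesis using b(2) by simp
      qed
    qed
    have "\<exists>w. G1 b = apply_fin (lmor ?d) w" for b
    proof (rule lmor_decode)
      show "no_square (\<not> ?d) (G1 b)" using image_no_square[OF sx2 y2(1) cc] .
      show "G1 b = [] \<or> hd (G1 b) = ?d"
        using hdp hdq by (cases rule: bool_eq_or_neg[of b p]) auto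
    qed
    then obtain G2 where G2: "\<And>b. G1 b = apply_fin (lmor ?d) (G2 b)" by metis
    have G1_eq: "G1 = comp_mor (lmor ?d) G2" by (rule ext) (simp add: comp_mor_def G2)
    have loc: "locally_sturmian G2"
      using locally_sturmian_lmor sx2 y2(1) sy2 unfolding G1_eq locally_sturmian_def by blast
    have len2: "length (G2 b) = count_list (G b) ?d" for b
      unfolding cnt1[symmetric] G2 count_lmor_same ..
    obtain w where w: "g ?q = apply_fin (lmor c) w @ [c]"
      using lmor_decode_last[of c "g ?q"] image_no_square[OF x im dd] ne gq by blast
    have "count_list (g ?q) c = length w + 1" unfolding w by (simp add: count_lmor_same)
    moreover have "count_list (g ?q) ?d = count_list w ?d" unfolding w by (simp add: count_lmor_other)
    ultimately have "count_list (g ?q) ?d < count_list (g ?q) c" using count_le_length[of w ?d] by simp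
    then have "length (G2 p) + length (G2 ?q) < length (g p) + length (g ?q)"
      unfolding len2 Gp Gq cnt[of "g p"] cnt[of "g ?q"] by simp
    then have "sturmian_mor G2" using IH loc by blast
    then show ?thesis unfolding G_eq G1_eq by (intro sturmian_mor.lmor)
  qed
  then have "length (g p) = 1 \<and> length (g ?q) = 1"
    using sturmian_mor_comp_lmor_letters[of g p] ne gp gq unfolding G_def by simp
  with False show ?thesis by blast
qed

text \<open>Induction on the total length of the images. If \<open>\<not> c\<close> is isolated in the image word and all images
  of letters end in \<open>c\<close>, or all begin with \<open>c\<close>, then an elementary morphism splits off on the left.\<close>

lemma locally_sturmian_imp_sturmian_mor: "locally_sturmian g \<Longrightarrow> sturmian_mor g"
proof (induction "length (g True) + length (g False)" arbitrary: g rule: less_induct)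
  case less
  obtain x y where x: "sturmian x" and im: "apply_inf g x = Inf y" and y: "sturmian y"
    using less.prems unfolding locally_sturmian_def by blast
  have ne: "g b \<noteq> []" for b using locally_sturmian_nonempty[OF less.prems] .
  have IH: "sturmian_mor h" if "length (h p) + length (h (\<not> p)) < length (g p) + length (g (\<not> p))"
    "locally_sturmian h" for h p
    using less.hyps[of h] that by (cases p) simp_all
  obtain c where dd: "[\<not> c, \<not> c] \<notin> factors y" using sturmian_length2(2)[OF y] by blast
  have nsq: "no_square (\<not> c) (g b)" for b by (rule image_no_square[OF x im dd])
  obtain b0 where b0: "(\<not> c) \<in> set (g b0)"
  proof (rule ccontr)
    assume "\<not> thesis"
    then have "(\<not> c) \<notin> set (g b)" for b using that by blast
    then have "g b = replicate (length (g b)) (\<not> (\<not> c))" for b by (rule no_letter_replicate)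
    then have "g b = concat (replicate (length (g b)) [c])" for b
      unfolding not_not by (metis concat_replicate_single)
    then have "eventually_periodic y" using eventually_periodic_image_of_powers[OF im] by blast
    with sturmian_aperiodic[OF y] show False by blast
  qed
  have smaller: "length (h b0) + length (h (\<not> b0)) < length (g b0) + length (g (\<not> b0))"
    if len: "\<And>b. length (g b) = length (apply_fin (lmor c) (h b))"
      and cnt: "\<And>b. count_list (g b) (\<not> c) = count_list (apply_fin (lmor c) (h b)) (\<not> c)" for h
  proof -
    have "count_list (g b0) (\<not> c) \<noteq> 0" using b0 by (simp add: count_list_0_iff)
    then show ?thesis using cnt[of b0] by (simp add: len length_lmor count_lmor_other)
  qed
  consider (last) "\<And>b. last (g b) = c" | (hd) "\<And>b. hd (g b) = c"
    | (none) b1 b2 where "last (g b1) = (\<not> c)" "hd (g b2) = (\<not> c)"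
    by blast
  then show ?case
  proof cases
    case last
    have "\<exists>w. g b = apply_fin (rmor c) w" for b using rmor_decode[OF nsq] last by blast
    then obtain h where h: "\<And>b. g b = apply_fin (rmor c) (h b)" by metis
    then have "g = comp_mor (rmor c) h" by (intro ext) (simp add: comp_mor_def)
    moreover have "sturmian_mor h"
    proof (rule IH[of h b0])
      show "locally_sturmian h" using locally_sturmian_rmor less.prems calculation by simp
    qed (rule smaller; simp add: h length_rmor count_list_rmor)
    ultimately show ?thesis by (simp add: sturmian_mor.rmor)
  next
    case hd
    have "\<exists>w. g b = apply_fin (lmor c) w" for b using lmor_decode[OF nsq] hd by blast
    then obtain h where h: "\<And>b. g b = apply_fin (lmor c) (h b)" by metis
    then have "g = comp_mor (lmor c) h" by (intro ext) (simp add: comp_mor_def)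
    moreover have "sturmian_mor h"
    proof (rule IH[of h b0])
      show "locally_sturmian h" using locally_sturmian_lmor less.prems calculation by simp
    qed (rule smaller; simp add: h)
    ultimately show ?thesis by (simp add: sturmian_mor.lmor)
  next
    case none
    \<comment> \<open>A letter whose image ends in \<open>\<not> c\<close> is never followed by one whose image starts with
      \<open>\<not> c\<close>; as both mixed pairs of letters occur in \<open>x\<close>, the two letters agree.\<close>
    have no_pair: False if ab: "[a, b] \<in> factors x" and la: "last (g a) = (\<not> c)"
      and hb: "hd (g b) = (\<not> c)" for a b
    proof -
      obtain u where u: "g a = u @ [\<not> c]" using ends_with[OF ne la] by blast
      obtain v where v: "g b = (\<not> c) # v" using starts_with[OF ne hb] by blast
      have "g a @ g b \<in> factors y" using image_in_factors[OF im ab] by simp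
      then have "u @ [\<not> c, \<not> c] @ v \<in> factors y" unfolding u v by simp
      then show False using dd factors_appendD by blast
    qed
    have b: "b1 = b2"
    proof (cases rule: bool_eq_or_neg[of b2 b1])
      case 2
      then show ?thesis using no_pair[OF sturmian_length2(1)[OF x, of b1]] none by simp
    qed simp
    have "hd (g (\<not> b2)) \<noteq> (\<not> c)"
      using no_pair[OF sturmian_length2(1)[OF x, of b2]] none(1) unfolding b by blast
    moreover have "last (g (\<not> b2)) \<noteq> (\<not> c)"
      using no_pair[OF sturmian_length2(1)[OF x, of "\<not> b2", unfolded not_not]] none(2) by blast
    moreover have "[b2, b2] \<notin> factors x" using no_pair[of b2 b2] none b by blast
    ultimately show ?thesis
      using locally_sturmian_no_common_end[OF x im y dd, of b2] none b ne IH by blast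
  qed
qed

section \<open>Words with Sturmian erasures over a binary coding\<close>

text \<open>The two letters other than \<open>l\<close> are coded by the truth values.\<close>

fun emb :: "letter \<Rightarrow> bool \<Rightarrow> letter" where
  "emb L0 b = (if b then L2 else L1)"
| "emb L1 b = (if b then L2 else L0)"
| "emb L2 b = (if b then L1 else L0)"

fun dec :: "letter \<Rightarrow> letter \<Rightarrow> bool" where
  "dec L0 a = (a = L2)"
| "dec L1 a = (a = L2)"
| "dec L2 a = (a = L1)"

definition code_erase :: "letter \<Rightarrow> (letter, bool) morphism" where
  "code_erase l a = (if a = l then [] else [dec l a])"

lemma emb_neq [simp]: "emb l b \<noteq> l"
  by (cases l) auto

lemma dec_emb [simp]: "dec l (emb l b) = b"
  by (cases l) auto

lemma emb_dec: "a \<noteq> l \<Longrightarrow> emb l (dec l a) = a"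
  by (cases l; cases a) auto

lemma inj_emb: "inj (emb l)"
  by (rule inj_on_inverseI[of _ "dec l"]) simp

lemma code_erase_emb [simp]: "code_erase l (emb l b) = [b]"
  by (simp add: code_erase_def)

lemma code_erase_self [simp]: "code_erase l l = []"
  by (simp add: code_erase_def)

lemma letter_eq_or_emb: obtains "a = l" | b where "a = emb l b"
  using emb_dec[of a l] by metis

lemma erase_eq_code: "erase l = comp_mor (\<lambda>b. [emb l b]) (code_erase l)"
  by (rule ext) (auto simp: erase_def comp_mor_def code_erase_def emb_dec)

lemma sturmian_erasures_iff:
  "sturmian_erasures x \<longleftrightarrow> (\<forall>l. \<exists>y. apply_inf (code_erase l) x = Inf y \<and> sturmian y)"
proof -
  have "(\<exists>z. apply_inf (erase l) x = Inf z \<and> sturmian z)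
      \<longleftrightarrow> (\<exists>y. apply_inf (code_erase l) x = Inf y \<and> sturmian y)" for l
  proof
    assume "\<exists>z. apply_inf (erase l) x = Inf z \<and> sturmian z"
    then obtain z where z: "apply_inf (erase l) x = Inf z" "sturmian z" by blast
    then obtain y where y: "apply_inf (code_erase l) x = Inf y" "apply_inf (\<lambda>b. [emb l b]) y = Inf z"
      unfolding erase_eq_code using apply_inf_comp_split by blast
    then have "z = emb l \<circ> y" using apply_inf_letters[of "emb l" y] by simp
    with z(2) y(1) sturmian_letters[OF inj_emb] show "\<exists>y. apply_inf (code_erase l) x = Inf y \<and> sturmian y"
      by blast
  next
    assume "\<exists>y. apply_inf (code_erase l) x = Inf y \<and> sturmian y"
    then obtain y where y: "apply_inf (code_erase l) x = Inf y" "sturmian y" by blast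
    then show "\<exists>z. apply_inf (erase l) x = Inf z \<and> sturmian z"
      unfolding erase_eq_code
      using apply_inf_comp[OF y(1) apply_inf_letters[of "emb l" y]] sturmian_letters[OF inj_emb] by blast
  qed
  then show ?thesis by (simp add: sturmian_erasures_def)
qed

text \<open>This reduces the study of erasing morphisms to that of morphisms from two letters.\<close>

lemma factor_through_erasure:
  assumes "f i = []"
  shows "f = comp_mor (\<lambda>b. f (emb i b)) (code_erase i)"
proof
  fix a show "f a = comp_mor (\<lambda>b. f (emb i b)) (code_erase i) a"
    by (cases rule: letter_eq_or_emb[of a i]) (simp_all add: comp_mor_def assms)
qed

lemma sturmian_erasures_image:
  assumes "\<And>l. sturmian_mor (comp_mor (code_erase l) F)" "sturmian y"
  shows "\<exists>z. apply_inf F y = Inf z \<and> sturmian_erasures z"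
proof -
  have im: "\<exists>w. apply_inf (comp_mor (code_erase l) F) y = Inf w \<and> sturmian w" for l
    by (rule sturmian_mor_preserves[OF assms])
  then obtain z where z: "apply_inf F y = Inf z"
    using apply_inf_comp_split by blast
  have "\<exists>w. apply_inf (code_erase l) z = Inf w \<and> sturmian w" for l
    using im[of l] apply_inf_comp_left[OF z] by blast
  with z show ?thesis by (simp add: sturmian_erasures_iff)
qed

text \<open>The erasures of \<open>F\<close> are binary morphisms that are locally Sturmian by hypothesis; a single image
  thus decides about all Sturmian words.\<close>

lemma sturmian_mor_of_image:
  assumes "sturmian y" "apply_inf F y = Inf z" "sturmian_erasures z"
  shows "sturmian_mor (comp_mor (code_erase l) F)"
proof -
  obtain w where "apply_inf (code_erase l) z = Inf w" "sturmian w"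
    using assms(3) by (auto simp: sturmian_erasures_iff)
  then have "locally_sturmian (comp_mor (code_erase l) F)"
    using assms(1) apply_inf_comp[OF assms(2)] unfolding locally_sturmian_def by blast
  then show ?thesis by (rule locally_sturmian_imp_sturmian_mor)
qed

lemma comp_code_erase_in_MSE:
  assumes "\<And>l. sturmian_mor (comp_mor (code_erase l) F)"
  shows "comp_mor F (code_erase i) \<in> MSE"
  unfolding MSE_def image_sturmian_erasures_def
proof (intro CollectI allI impI)
  fix x assume "sturmian_erasures x"
  then obtain y where y: "apply_inf (code_erase i) x = Inf y" "sturmian y"
    by (auto simp: sturmian_erasures_iff)
  obtain z where "apply_inf F y = Inf z" "sturmian_erasures z"
    using sturmian_erasures_image[OF assms y(2)] by blast
  then show "\<exists>z. apply_inf (comp_mor F (code_erase i)) x = Inf z \<and> sturmian_erasures z"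
    using apply_inf_comp[OF y(1)] by blast
qed

lemma sturmian_mor_of_erasing_image:
  assumes "sturmian_erasures x" "image_sturmian_erasures (comp_mor F (code_erase i)) x"
  shows "sturmian_mor (comp_mor (code_erase l) F)"
proof -
  obtain z where z: "apply_inf (comp_mor F (code_erase i)) x = Inf z" "sturmian_erasures z"
    using assms(2) unfolding image_sturmian_erasures_def by blast
  obtain y where y: "apply_inf (code_erase i) x = Inf y" "sturmian y"
    using assms(1) by (auto simp: sturmian_erasures_iff)
  show ?thesis by (rule sturmian_mor_of_image[OF y(2) apply_inf_comp_left[OF y(1) z(1)] z(2)])
qed

text \<open>After erasing \<open>i\<close>, the morphism acts on a Sturmian word over two letters, and its erasures are
  Sturmian because they are so locally.\<close>

lemma erasing_locally_sturmian_erasures_in_MSE: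
  assumes "locally_sturmian_erasures f" "f i = []"
  shows "f \<in> MSE"
proof -
  let ?F = "\<lambda>b. f (emb i b)"
  have f: "f = comp_mor ?F (code_erase i)" by (rule factor_through_erasure) (rule assms(2))
  obtain x where x: "sturmian_erasures x" "image_sturmian_erasures f x"
    using assms(1) unfolding locally_sturmian_erasures_def by blast
  from x(2) f have "image_sturmian_erasures (comp_mor ?F (code_erase i)) x" by simp
  then have "sturmian_mor (comp_mor (code_erase l) ?F)" for l
    by (rule sturmian_mor_of_erasing_image[OF x(1)])
  then have "comp_mor ?F (code_erase i) \<in> MSE" by (rule comp_code_erase_in_MSE)
  with f show ?thesis by simp
qed

section \<open>Nonerasing morphisms\<close>

text \<open>Inserting the letter \<open>m\<close> after every letter turns a Sturmian word over the other two letters into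
  a word with Sturmian erasures. The three words obtained in this way from \<^term>\<open>fib_word\<close> are the
  only ones needed to test nonerasing morphisms.\<close>

definition insert_letter :: "letter \<Rightarrow> (bool, letter) morphism" where
  "insert_letter m b = [emb m b, m]"

lemma sturmian_mor_insert_letter: "sturmian_mor (comp_mor (code_erase l) (insert_letter m))"
  (is "sturmian_mor ?h")
proof -
  have "(\<forall>b. ?h b = [b]) \<or> (\<exists>c. \<forall>b. ?h b = rmor c b) \<or> (\<exists>c. \<forall>b. ?h b = rmor c (\<not> b))"
    by (cases l; cases m)
      (simp_all add: all_bool_eq ex_bool_eq rmor_def comp_mor_def insert_letter_def code_erase_def)
  moreover have "sturmian_mor h" if "\<forall>b. h b = rmor c b" for h c
  proof -
    have "h = comp_mor (rmor c) (\<lambda>b. [b])" using that by (intro ext) (simp add: comp_mor_def)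
    then show ?thesis using sturmian_mor.rmor[OF sturmian_mor.ident] by simp
  qed
  moreover have "sturmian_mor h" if "\<forall>b. h b = rmor c (\<not> b)" for h c
  proof -
    have "h = comp_mor (rmor c) (\<lambda>b. [\<not> b])" using that by (intro ext) (simp add: comp_mor_def)
    then show ?thesis using sturmian_mor.rmor[OF sturmian_mor.swap] by simp
  qed
  moreover have "sturmian_mor h" if "\<forall>b. h b = [b]" for h
  proof -
    have "h = (\<lambda>b. [b])" using that by (intro ext) simp
    then show ?thesis using sturmian_mor.ident by simp
  qed
  ultimately show ?thesis by (elim disjE exE) simp_all
qed

lemma sturmian_erasures_insert_letter:
  "\<exists>z. apply_inf (insert_letter m) fib_word = Inf z \<and> sturmian_erasures z"
  by (rule sturmian_erasures_image[OF sturmian_mor_insert_letter sturmian_fib_word])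

lemma det_mor_insert_letter:
  "det_mor (\<lambda>b. h (emb m b) @ h m) False True
    = det_mor h (emb m False) (emb m True) + det_mor h (emb m False) m + det_mor h m (emb m True)"
  by (simp add: det_mor_def algebra_simps)

lemma det_mor_swap: "det_mor h a b = - det_mor h b a"
  by (simp add: det_mor_def)

text \<open>The determinant of the composition with \<^term>\<open>insert_letter m\<close> is, up to sign, a sum of the
  three minors \<open>d\<^sub>0\<^sub>1\<close>, \<open>d\<^sub>0\<^sub>2\<close>, \<open>d\<^sub>1\<^sub>2\<close> of the \<open>2 \<times> 3\<close> incidence matrix, with signs depending on
  \<open>m\<close>. All three sums are units only if two of the minors vanish or the three agree up to sign;
  the Pluecker relation between the columns then makes a column zero.\<close>

lemma det_units_erase:
  assumes "\<And>m. \<bar>det_mor (\<lambda>b. h (emb m b) @ h m) False True\<bar> = 1"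
  shows "\<exists>a. h a = []"
proof -
  define d01 d02 d12 where "d01 = det_mor h L0 L1" and "d02 = det_mor h L0 L2" and "d12 = det_mor h L1 L2"
  let ?n = "\<lambda>a b. int (count_list (h a) b)"
  have e: "\<bar>d12 - d01 + d02\<bar> = 1" "\<bar>d02 + d01 + d12\<bar> = 1" "\<bar>d01 + d02 - d12\<bar> = 1"
    using assms[of L0] assms[of L1] assms[of L2]
      det_mor_swap[of h L1 L0] det_mor_swap[of h L2 L0] det_mor_swap[of h L2 L1]
    unfolding det_mor_insert_letter d01_def d02_def d12_def by simp_all
  have pl: "?n L0 b * d12 - ?n L1 b * d02 + ?n L2 b * d01 = 0" for b
    by (cases b) (simp_all add: d01_def d02_def d12_def det_mor_def algebra_simps)
  have nil: "h a = []" if "\<And>b. ?n a b = 0" for a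
    using that[of True] that[of False] count_list_both[of "h a"] by simp
  have "d01 = 0 \<and> d12 = 0 \<and> d02 \<noteq> 0 \<or> d12 = 0 \<and> d02 = 0 \<and> d01 \<noteq> 0
      \<or> d01 = 0 \<and> d02 = 0 \<and> d12 \<noteq> 0 \<or> d01 = - d02 \<and> d12 = - d02 \<and> d02 \<noteq> 0"
  proof -
    have "d12 - d01 + d02 = 1 \<or> d12 - d01 + d02 = -1" "d02 + d01 + d12 = 1 \<or> d02 + d01 + d12 = -1"
      "d01 + d02 - d12 = 1 \<or> d01 + d02 - d12 = -1"
      using e by linarith+
    then show ?thesis by (elim disjE) presburger+
  qed
  then consider "d01 = 0" "d12 = 0" "d02 \<noteq> 0" | "d12 = 0" "d02 = 0" "d01 \<noteq> 0"
    | "d01 = 0" "d02 = 0" "d12 \<noteq> 0" | "d01 = - d02" "d12 = - d02" "d02 \<noteq> 0"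
    by blast
  then show ?thesis
  proof cases
    case 1
    have "?n L1 b = 0" for b using pl[of b] 1 by simp
    then show ?thesis using nil by blast
  next
    case 2
    have "?n L2 b = 0" for b using pl[of b] 2 by simp
    then show ?thesis using nil by blast
  next
    case 3
    have "?n L0 b = 0" for b using pl[of b] 3 by simp
    then show ?thesis using nil by blast
  next
    case 4
    have "?n L0 b = 0" for b
    proof -
      have "d02 * (?n L0 b + ?n L1 b + ?n L2 b) = 0" using pl[of b] unfolding 4(1,2) by (simp add: algebra_simps)
      with 4(3) have "?n L0 b + ?n L1 b + ?n L2 b = 0" by simp
      then show ?thesis by linarith
    qed
    then show ?thesis using nil by blast
  qed
qed

lemma MSE_det:
  assumes "f \<in> MSE"
  shows "\<bar>det_mor (\<lambda>b. comp_mor (code_erase l) f (emb m b) @ comp_mor (code_erase l) f m) False True\<bar> = 1"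
proof -
  obtain x where x: "apply_inf (insert_letter m) fib_word = Inf x" "sturmian_erasures x"
    using sturmian_erasures_insert_letter by blast
  obtain z where z: "apply_inf f x = Inf z" "sturmian_erasures z"
    using assms x(2) unfolding MSE_def image_sturmian_erasures_def by blast
  have "sturmian_mor (comp_mor (code_erase l) (comp_mor f (insert_letter m)))"
    by (rule sturmian_mor_of_image[OF sturmian_fib_word apply_inf_comp[OF x(1) z(1)] z(2)])
  from sturmian_mor_det[OF this] show ?thesis
    by (simp add: comp_mor_def insert_letter_def)
qed

lemma code_erase_Nil_iff: "apply_fin (code_erase l) w = [] \<longleftrightarrow> set w \<subseteq> {l}"
  by (induction w) (auto simp: code_erase_def)

lemma count_list_replicate: "count_list (replicate n a) b = (if a = b then n else 0)"
  by (induction n) auto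

lemma finite_letters: "finite (UNIV :: letter set)"
proof -
  have "(UNIV :: letter set) = {L0, L1, L2}" using letter.exhaust by auto
  then show ?thesis by (metis finite.emptyI finite.insertI)
qed

text \<open>For every letter \<open>l\<close>, some letter becomes empty when \<open>f\<close> is followed by the erasure of \<open>l\<close>; its
  image under \<open>f\<close> is therefore a power of \<open>l\<close>. This assigns to the letters \<open>l\<close> distinct letters, and
  the determinants force the exponents to be \<open>1\<close>.\<close>

lemma nonerasing_MSE_permutation:
  assumes f: "f \<in> MSE" and ne: "\<And>a. f a \<noteq> []"
  shows "f \<in> permutation_morphisms"
proof -
  have "\<exists>a. comp_mor (code_erase l) f a = []" for l
    using det_units_erase MSE_det[OF f] by blast
  then have "\<exists>a. set (f a) \<subseteq> {l}" for l by (simp add: comp_mor_def code_erase_Nil_iff)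
  then obtain s where s: "\<And>l. set (f (s l)) \<subseteq> {l}" by metis
  have inj: "s l \<noteq> s l'" if "l \<noteq> l'" for l l'
  proof
    assume "s l = s l'"
    then have "set (f (s l)) \<subseteq> {l} \<inter> {l'}" using s by (metis Int_subset_iff)
    with that have "set (f (s l)) = {}" by auto
    with ne show False by simp
  qed
  have one: "f (s l) = [l]" for l
  proof -
    define l' where "l' = emb l True"
    have l': "l' \<noteq> l" by (simp add: l'_def)
    define k where "k = length (f (s l))"
    have "f (s l) = replicate k l" using s[of l] unfolding k_def by (intro replicate_eqI) auto
    then have hk: "comp_mor (code_erase l') f (s l) = replicate k (dec l' l)"
      using l' by (induction k arbitrary: f) (simp_all add: comp_mor_def apply_fin_def code_erase_def concat_map_singleton)
    \<comment> \<open>The letter \<open>s l'\<close> is erased, so the determinant is that of the other two columns, and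
      one of them is divisible by \<open>k\<close>.\<close>
    let ?h = "comp_mor (code_erase l') f" and ?m = "s l'"
    have hm: "?h ?m = []" using s[of l'] by (simp add: comp_mor_def code_erase_Nil_iff)
    have d: "\<bar>det_mor ?h (emb ?m False) (emb ?m True)\<bar> = 1"
      using MSE_det[OF f, of l' ?m] hm by (simp add: det_mor_def)
    obtain b where b: "s l = emb ?m b"
      using inj[OF l'] by (metis emb_dec)
    have "int k dvd det_mor ?h (emb ?m False) (emb ?m True)"
    proof -
      have "int k dvd int (count_list (?h (emb ?m b)) e)" for e
        unfolding b[symmetric] hk by (simp add: count_list_replicate)
      then show ?thesis unfolding det_mor_def by (cases b) (auto intro!: dvd_diff dvd_mult dvd_mult2)
    qed
    then have "int k dvd 1" using d by (metis dvd_abs_iff)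
    then have "k = 1" by simp
    with \<open>f (s l) = replicate k l\<close> show ?thesis by simp
  qed
  have "inj s" using inj unfolding inj_def by blast
  then have "bij s" using finite_UNIV_inj_surj[OF finite_letters] by (simp add: bij_def)
  have "s (inv_into UNIV s a) = a" for a using bij_is_surj[OF \<open>bij s\<close>] by (rule surj_f_inv_f)
  then have "f = (\<lambda>a. [inv_into UNIV s a])" using one by (intro ext) (metis)
  then show ?thesis using bij_imp_bij_inv[OF \<open>bij s\<close>] unfolding permutation_morphisms_def by blast
qed

text \<open>Erasing \<open>l\<close> after a permutation \<open>p\<close> amounts to erasing the preimage of \<open>l\<close> and renaming the remaining
  two letters.\<close>

lemma permutation_in_MSE:
  assumes "bij p"
  shows "(\<lambda>a. [p a]) \<in> MSE"
  unfolding MSE_def image_sturmian_erasures_def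
proof (intro CollectI allI impI)
  fix x assume x: "sturmian_erasures x"
  have "\<exists>w. apply_inf (code_erase l) (p \<circ> x) = Inf w \<and> sturmian w" for l
  proof -
    obtain i where i: "p i = l" using bij_is_surj[OF assms] by (metis surjD)
    have pi: "p a = l \<longleftrightarrow> a = i" for a using bij_is_inj[OF assms] i by (metis injD)
    obtain y where y: "apply_inf (code_erase i) x = Inf y" "sturmian y"
      using x by (auto simp: sturmian_erasures_iff)
    define t where "t b = dec l (p (emb i b))" for b
    have "inj t"
    proof (rule injI)
      fix b b' assume "t b = t b'"
      have "p (emb i b) = emb l (t b)" for b
        using emb_dec[of "p (emb i b)" l] by (simp add: t_def pi)
      with \<open>t b = t b'\<close> have "p (emb i b) = p (emb i b')" by simp
      then have "emb i b = emb i b'" using bij_is_inj[OF assms] by (simp only: inj_eq)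
      then show "b = b'" using inj_emb[of i] by (simp only: inj_eq)
    qed
    have "comp_mor (code_erase l) (\<lambda>a. [p a]) = comp_mor (\<lambda>b. [t b]) (code_erase i)"
    proof
      fix a show "comp_mor (code_erase l) (\<lambda>a. [p a]) a = comp_mor (\<lambda>b. [t b]) (code_erase i) a"
        by (cases "a = i") (simp_all add: comp_mor_def code_erase_def pi t_def emb_dec)
    qed
    then have "apply_inf (comp_mor (code_erase l) (\<lambda>a. [p a])) x = Inf (t \<circ> y)"
      using apply_inf_comp[OF y(1) apply_inf_letters[of t y]] by simp
    from apply_inf_comp_left[OF apply_inf_letters this] show ?thesis
      using sturmian_letters[OF \<open>inj t\<close>] y(2) by blast
  qed
  then have "sturmian_erasures (p \<circ> x)" by (simp add: sturmian_erasures_iff)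
  with apply_inf_letters[of p x] show "\<exists>z. apply_inf (\<lambda>a. [p a]) x = Inf z \<and> sturmian_erasures z" by blast
qed

lemma MSE_eq: "MSE = MSE_eps \<union> permutation_morphisms"
proof
  show "MSE \<subseteq> MSE_eps \<union> permutation_morphisms"
    using nonerasing_MSE_permutation unfolding MSE_eps_def by blast
  show "MSE_eps \<union> permutation_morphisms \<subseteq> MSE"
    using permutation_in_MSE unfolding MSE_eps_def permutation_morphisms_def by blast
qed

section \<open>The monoid is not finitely generated\<close>

text \<open>The morphism with \<open>0 \<mapsto> (21)\<^sup>n20\<close>, \<open>1 \<mapsto> 12\<close>, \<open>2 \<mapsto> \<epsilon>\<close>. The two nonempty images have different first
  and different last letters, so that only bijections of the two letters split off on the right,
  while the length of the first image is unbounded.\<close>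

definition irreducible_coding :: "nat \<Rightarrow> (bool, letter) morphism" where
  "irreducible_coding n b = (if b then [L1, L2] else concat (replicate n [L2, L1]) @ [L2, L0])"

definition irreducible_mor :: "nat \<Rightarrow> (letter, letter) morphism" where
  "irreducible_mor n = comp_mor (irreducible_coding n) (code_erase L2)"

lemma irreducible_mor_simps:
  "irreducible_mor n L0 = irreducible_coding n False" "irreducible_mor n L1 = irreducible_coding n True" "irreducible_mor n L2 = []"
  by (simp_all add: irreducible_mor_def comp_mor_def code_erase_def)

lemma sturmian_mor_lmor_power: "sturmian_mor (\<lambda>b. if b then [True] else replicate n True @ [False])"
proof (induction n)
  case 0
  have "(\<lambda>b. if b then [True] else replicate 0 True @ [False]) = (\<lambda>b. [b])" by (rule ext) simp
  then show ?case using sturmian_mor.ident by simp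
next
  case (Suc n)
  have "apply_fin (lmor True) (replicate n True) = replicate n True"
    by (induction n) (simp_all add: lmor_def)
  then have "(\<lambda>b. if b then [True] else replicate (Suc n) True @ [False])
      = comp_mor (lmor True) (\<lambda>b. if b then [True] else replicate n True @ [False])"
    by (intro ext) (simp add: comp_mor_def lmor_def replicate_append_same[symmetric])
  then show ?case using sturmian_mor.lmor[OF Suc, of True] by simp
qed

lemma sturmian_mor_rmor_power: "sturmian_mor (\<lambda>b. if b then [False] else True # replicate n False)"
proof (induction n)
  case 0
  have "(\<lambda>b. if b then [False] else True # replicate 0 False) = (\<lambda>b. [\<not> b])" by (rule ext) simp
  then show ?case using sturmian_mor.swap by simp
next
  case (Suc n)
  have "apply_fin (rmor False) (replicate n False) = replicate n False"
    by (induction n) (simp_all add: rmor_def)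
  then have "(\<lambda>b. if b then [False] else True # replicate (Suc n) False)
      = comp_mor (rmor False) (\<lambda>b. if b then [False] else True # replicate n False)"
    by (intro ext) (simp add: comp_mor_def rmor_def)
  then show ?case using sturmian_mor.rmor[OF Suc, of False] by simp
qed

lemma sturmian_mor_irreducible_coding: "sturmian_mor (comp_mor (code_erase l) (irreducible_coding n))"
proof (cases l)
  case L0
  have "apply_fin (rmor True) (replicate n False) = concat (replicate n [False, True])"
    by (induction n) (simp_all add: rmor_def)
  moreover have "apply_fin (code_erase L0) (concat (replicate n [L2, L1])) = concat (replicate n [True, False])"
    by (induction n) (simp_all add: code_erase_def)
  moreover have "True # concat (replicate n [False, True]) = concat (replicate n [True, False]) @ [True]"
    by (induction n) simp_all
  ultimately have "comp_mor (code_erase l) (irreducible_coding n)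
      = comp_mor (rmor True) (\<lambda>b. if b then [False] else True # replicate n False)"
    unfolding L0 by (intro ext) (simp add: comp_mor_def irreducible_coding_def rmor_def code_erase_def)
  then show ?thesis using sturmian_mor.rmor[OF sturmian_mor_rmor_power[of n], of True] by simp
next
  case L1
  have "apply_fin (code_erase L1) (concat (replicate n [L2, L1])) = replicate n True"
    by (induction n) (simp_all add: code_erase_def)
  then have "comp_mor (code_erase l) (irreducible_coding n)
      = (\<lambda>b. if b then [True] else replicate (Suc n) True @ [False])"
    unfolding L1 by (intro ext) (simp add: comp_mor_def irreducible_coding_def code_erase_def replicate_append_same[symmetric])
  then show ?thesis using sturmian_mor_lmor_power by metis
next
  case L2
  have "apply_fin (code_erase L2) (concat (replicate n [L2, L1])) = replicate n True"
    by (induction n) (simp_all add: code_erase_def)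
  then have "comp_mor (code_erase l) (irreducible_coding n) = (\<lambda>b. if b then [True] else replicate n True @ [False])"
    unfolding L2 by (intro ext) (simp add: comp_mor_def irreducible_coding_def code_erase_def)
  then show ?thesis using sturmian_mor_lmor_power by metis
qed

lemma irreducible_mor_in_MSE: "irreducible_mor n \<in> MSE"
  unfolding irreducible_mor_def by (rule comp_code_erase_in_MSE[OF sturmian_mor_irreducible_coding])

lemma irreducible_coding_ends:
  "hd (irreducible_coding n False) \<noteq> hd (irreducible_coding n True)"
  "last (irreducible_coding n False) \<noteq> last (irreducible_coding n True)"
  by (cases n; simp add: irreducible_coding_def)+

lemma irreducible_coding_nonempty: "irreducible_coding n b \<noteq> []"
  by (simp add: irreducible_coding_def)

lemma apply_fin_erased_power:
  "K c = [] \<Longrightarrow> \<exists>m. apply_fin K w = concat (replicate m (K (\<not> c)))"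
proof (induction w)
  case Nil
  show ?case by (intro exI[of _ 0]) simp
next
  case (Cons b w)
  then obtain m where m: "apply_fin K w = concat (replicate m (K (\<not> c)))" by blast
  show ?case
  proof (cases rule: bool_eq_or_neg[of b c])
    case 1
    then show ?thesis using m Cons.prems by (intro exI[of _ m]) simp
  next
    case 2
    then show ?thesis using m by (intro exI[of _ "Suc m"]) simp
  qed
qed

lemma hd_concat_replicate: "concat (replicate m u) \<noteq> [] \<Longrightarrow> hd (concat (replicate m u)) = hd u"
  by (cases m; cases u) auto

lemma last_concat_replicate: "concat (replicate m u) \<noteq> [] \<Longrightarrow> last (concat (replicate m u)) = last u"
proof (induction m)
  case (Suc m)
  then show ?case by (cases "concat (replicate m u) = []") (auto simp: last_append)
qed simp

text \<open>A common first or last letter of the images under \<open>t\<close> would produce a common first or last letter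
  of the composite images, even if \<open>K\<close> erases that letter, as both images are then powers of one
  word. So \<open>t\<close> only renames letters.\<close>

lemma irreducible_coding_factor:
  assumes F: "\<And>b. irreducible_coding n b = apply_fin K (t b)" and t: "sturmian_mor t"
  shows "\<exists>b. irreducible_coding n False = K b"
proof -
  have no_hd: False if u: "\<And>b. t b = c # u b" for c u
  proof (cases "K c = []")
    case True
    have "hd (irreducible_coding n b) = hd (K (\<not> c))" for b
      using apply_fin_erased_power[of K c "t b"] True F[of b] irreducible_coding_nonempty[of n b] hd_concat_replicate
      by metis
    then show False using irreducible_coding_ends(1)[of n] by simp
  next
    case False
    have "hd (irreducible_coding n b) = hd (K c)" for b unfolding F u using False by simp
    then show False using irreducible_coding_ends(1)[of n] by simp
  qed
  have no_last: False if u: "\<And>b. t b = u b @ [c]" for c u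
  proof (cases "K c = []")
    case True
    have "last (irreducible_coding n b) = last (K (\<not> c))" for b
      using apply_fin_erased_power[of K c "t b"] True F[of b] irreducible_coding_nonempty[of n b] last_concat_replicate
      by metis
    then show False using irreducible_coding_ends(2)[of n] by simp
  next
    case False
    have "last (irreducible_coding n b) = last (K c)" for b unfolding F u using False by simp
    then show False using irreducible_coding_ends(2)[of n] by simp
  qed
  from sturmian_mor_common_end[OF t] show ?thesis
  proof (elim disjE exE)
    assume "t = (\<lambda>b. [b])"
    then show ?thesis using F[of False] by auto
  next
    assume "t = (\<lambda>b. [\<not> b])"
    then show ?thesis using F[of False] by auto
  next
    fix c assume "\<forall>b. \<exists>u. t b = c # u"
    then obtain u where "\<And>b. t b = c # u b" by metis
    with no_hd show ?thesis by blast
  next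
    fix c assume "\<forall>b. \<exists>u. t b = u @ [c]"
    then obtain u where "\<And>b. t b = u b @ [c]" by metis
    with no_last show ?thesis by blast
  qed
qed

text \<open>If \<open>r\<close> is not a permutation, it erases the letter \<open>2\<close>, and what lies between the erasures of \<open>2\<close> and
  \<open>c\<close> is a binary Sturmian morphism, to which the previous lemma applies.\<close>

lemma irreducible_mor_left_factor:
  assumes fac: "irreducible_mor n = comp_mor G r" and G: "G c = []" and r: "r \<in> MSE"
  shows "\<exists>a. irreducible_mor n L0 = G a"
proof -
  have app: "irreducible_mor n a = apply_fin G (r a)" for a unfolding fac comp_mor_def ..
  have "r \<in> MSE_eps \<or> r \<in> permutation_morphisms" using r MSE_eq by blast
  then consider d where "r d = []" | p where "r = (\<lambda>a. [p a])"
    unfolding MSE_eps_def permutation_morphisms_def by blast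
  then show ?thesis
  proof cases
    case 1
    have "d = L2"
    proof (rule ccontr)
      assume "d \<noteq> L2"
      then have "irreducible_mor n d \<noteq> []" using irreducible_coding_nonempty by (cases d) (simp_all add: irreducible_mor_simps)
      with app[of d] 1 show False by simp
    qed
    define R where "R b = r (emb L2 b)" for b
    have rR: "r = comp_mor R (code_erase L2)" unfolding R_def
      by (rule factor_through_erasure) (use 1 \<open>d = L2\<close> in simp)
    obtain x where x: "sturmian_erasures x" using sturmian_erasures_insert_letter by blast
    have "image_sturmian_erasures r x" using r x unfolding MSE_def by blast
    then have "image_sturmian_erasures (comp_mor R (code_erase L2)) x" unfolding rR[symmetric] .
    then have t: "sturmian_mor (comp_mor (code_erase c) R)" by (rule sturmian_mor_of_erasing_image[OF x])
    define K where "K b = G (emb c b)" for b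
    have GK: "G = comp_mor K (code_erase c)" unfolding K_def by (rule factor_through_erasure) (rule G)
    have "irreducible_coding n b = apply_fin K (comp_mor (code_erase c) R b)" for b
    proof -
      have "irreducible_coding n b = irreducible_mor n (emb L2 b)" by (cases b) (simp_all add: irreducible_mor_simps)
      also have "\<dots> = apply_fin G (R b)" unfolding R_def by (rule app)
      also have "\<dots> = apply_fin (comp_mor K (code_erase c)) (R b)" unfolding GK[symmetric] ..
      finally show ?thesis by (simp add: apply_fin_comp comp_mor_apply)
    qed
    from irreducible_coding_factor[OF this t] obtain b where "irreducible_coding n False = K b" by blast
    then show ?thesis unfolding irreducible_mor_simps K_def by blast
  next
    case 2
    then show ?thesis using app[of L0] by auto
  qed
qed

text \<open>A submonoid that contains every given finite subset of MSE once \<open>N\<close> is large: in a product of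
  generators, the permutations on the left and the first erasing generator form the factor \<open>G\<close>, whose
  images are no longer than those of that generator.\<close>

definition left_factor_bounded :: "nat \<Rightarrow> (letter, letter) morphism set" where
  "left_factor_bounded N = {f \<in> MSE. f \<in> permutation_morphisms \<or>
     (\<exists>G r. G \<in> MSE_eps \<and> (\<forall>a. length (G a) \<le> N) \<and> r \<in> MSE \<and> f = comp_mor G r)}"

lemma comp_mor_assoc: "comp_mor (comp_mor f g) h = comp_mor f (comp_mor g h)"
  by (rule ext) (simp add: comp_mor_def apply_fin_comp[unfolded comp_mor_def])

lemma comp_mor_id: "comp_mor f id_mor = f"
  by (rule ext) (simp add: comp_mor_def id_mor_def)

lemma id_mor_permutation: "id_mor \<in> permutation_morphisms"
  unfolding permutation_morphisms_def id_mor_def by (intro CollectI exI[of _ id]) simp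

lemma length_apply_fin_letters: "length (apply_fin (\<lambda>a. [p a]) w) = length w"
  by (induction w) simp_all

lemma submonoid_left_factor_bounded: "submonoid (left_factor_bounded N) MSE_monoid"
proof
  show "left_factor_bounded N \<subseteq> carrier MSE_monoid"
    by (auto simp: left_factor_bounded_def MSE_monoid_def)
  show "\<one>\<^bsub>MSE_monoid\<^esub> \<in> left_factor_bounded N"
    using id_mor_permutation MSE_eq by (auto simp: left_factor_bounded_def MSE_monoid_def)
  fix f g assume f: "f \<in> left_factor_bounded N" and g: "g \<in> left_factor_bounded N"
  then have fM: "f \<in> MSE" and gM: "g \<in> MSE" by (auto simp: left_factor_bounded_def)
  then have fg: "comp_mor f g \<in> MSE" by (rule comp_mor_in_MSE)
  have "comp_mor f g \<in> permutation_morphisms \<or>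
     (\<exists>G r. G \<in> MSE_eps \<and> (\<forall>a. length (G a) \<le> N) \<and> r \<in> MSE \<and> comp_mor f g = comp_mor G r)"
  proof (cases "f \<in> permutation_morphisms")
    case True
    then obtain p where p: "bij p" "f = (\<lambda>a. [p a])" unfolding permutation_morphisms_def by blast
    show ?thesis
    proof (cases "g \<in> permutation_morphisms")
      case True
      then obtain q where q: "bij q" "g = (\<lambda>a. [q a])" unfolding permutation_morphisms_def by blast
      have "comp_mor f g = (\<lambda>a. [(p \<circ> q) a])" unfolding p(2) q(2) by (rule ext) (simp add: comp_mor_def)
      then show ?thesis using bij_comp[OF q(1) p(1)] unfolding permutation_morphisms_def by blast
    next
      case False
      then obtain G r where G: "G \<in> MSE_eps" "\<forall>a. length (G a) \<le> N" "r \<in> MSE" "g = comp_mor G r"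
        using g unfolding left_factor_bounded_def by blast
      obtain l where "G \<in> MSE" "G l = []" using G(1) unfolding MSE_eps_def by blast
      then have "comp_mor f G \<in> MSE" "comp_mor f G l = []"
        using comp_mor_in_MSE[OF fM] by (simp_all add: comp_mor_def)
      then have "comp_mor f G \<in> MSE_eps" unfolding MSE_eps_def by blast
      moreover have "\<forall>a. length (comp_mor f G a) \<le> N"
        using G(2) unfolding p(2) by (simp add: comp_mor_def length_apply_fin_letters)
      moreover have "comp_mor f g = comp_mor (comp_mor f G) r" unfolding G(4) comp_mor_assoc ..
      ultimately show ?thesis using G(3) by blast
    qed
  next
    case False
    then obtain G r where G: "G \<in> MSE_eps" "\<forall>a. length (G a) \<le> N" "r \<in> MSE" "f = comp_mor G r"
      using f unfolding left_factor_bounded_def by blast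
    have "comp_mor f g = comp_mor G (comp_mor r g)" unfolding G(4) comp_mor_assoc ..
    then show ?thesis using G comp_mor_in_MSE[OF G(3) gM] by blast
  qed
  with fg show "f \<otimes>\<^bsub>MSE_monoid\<^esub> g \<in> left_factor_bounded N"
    by (simp add: left_factor_bounded_def MSE_monoid_def)
qed

lemma irreducible_mor_not_left_factor_bounded: "irreducible_mor N \<notin> left_factor_bounded N"
proof
  assume "irreducible_mor N \<in> left_factor_bounded N"
  moreover have "irreducible_mor N \<notin> permutation_morphisms"
  proof
    assume "irreducible_mor N \<in> permutation_morphisms"
    then obtain p where "irreducible_mor N = (\<lambda>a. [p a])" unfolding permutation_morphisms_def by blast
    then show False using irreducible_mor_simps(3)[of N] by simp
  qed
  ultimately obtain G r where G: "G \<in> MSE_eps" "\<And>a. length (G a) \<le> N" "r \<in> MSE" "irreducible_mor N = comp_mor G r"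
    unfolding left_factor_bounded_def by blast
  then obtain a where "irreducible_mor N L0 = G a" using irreducible_mor_left_factor unfolding MSE_eps_def by blast
  moreover have "N < length (irreducible_mor N L0)"
    by (simp add: irreducible_mor_simps irreducible_coding_def length_concat sum_list_replicate)
  ultimately show False using G(2)[of a] by simp
qed

lemma MSE_not_finitely_generated: "\<not> finitely_generated MSE_monoid"
proof
  assume "finitely_generated MSE_monoid"
  then obtain S where S: "finite S" "S \<subseteq> MSE" "generated_submonoid MSE_monoid S = MSE"
    unfolding finitely_generated_def by (auto simp: MSE_monoid_def)
  define lens where "lens = (\<lambda>(s, a). length (s a)) ` (S \<times> (UNIV :: letter set))"
  have "finite lens" unfolding lens_def using S(1) finite_letters by simp
  define N where "N = Max lens"
  have N: "length (s a) \<le> N" if "s \<in> S" for s a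
    unfolding N_def using \<open>finite lens\<close> that by (intro Max_ge) (auto simp: lens_def)
  have id: "id_mor \<in> MSE" using id_mor_permutation MSE_eq by blast
  have "S \<subseteq> left_factor_bounded N"
  proof
    fix s assume s: "s \<in> S"
    show "s \<in> left_factor_bounded N"
    proof (cases "s \<in> permutation_morphisms")
      case True
      then show ?thesis using s S(2) by (auto simp: left_factor_bounded_def)
    next
      case False
      then have "s \<in> MSE_eps" "s \<in> MSE" using s S(2) MSE_eq by auto
      with N[OF s] id comp_mor_id[of s, symmetric] show ?thesis unfolding left_factor_bounded_def by blast
    qed
  qed
  then have "generated_submonoid MSE_monoid S \<subseteq> left_factor_bounded N"
    using submonoid_left_factor_bounded unfolding generated_submonoid_def by blast
  with S(3) irreducible_mor_in_MSE[of N] irreducible_mor_not_left_factor_bounded[of N] show False by blast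
qed

theorem theorem1:
  shows "\<not> finitely_generated MSE_monoid \<and>
    MSE = MSE_eps \<union> permutation_morphisms \<and>
    (\<forall>f. locally_sturmian_erasures f \<and> (\<exists>i. f i = []) \<longrightarrow> f \<in> MSE)"
  using MSE_not_finitely_generated MSE_eq erasing_locally_sturmian_erasures_in_MSE by blast

end
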